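(* Consider system (5) in the standing setup with fixed $\sigma$ and weights, and suppose that the joint follower graph $\mathcal G^F([0,+\infty))$ is acyclic (contains no directed cycle). Then system (5) is SiISS with respect to $\mathcal L(y(t))$ if and only if $\mathcal G_{\sigma(t)}$ is jointly L-connected (JLC).
   Context: Standing setup. Fix integers $n\ge 2$, $k\ge 1$, $d\ge 1$. The follower set is $\mathcal V_F=\{1,\dots,n\}$ and the leader set is $\mathcal V_L=\{\hat 1,\dots,\hat k\}$ (disjoint from $\mathcal V_F$); $\mathcal V=\mathcal V_F\cup\mathcal V_L$. The interaction topology is a time-varying digraph $\mathcal G_{\sigma(t)}=(\mathcal V,\mathcal E_{\sigma(t)})$, where $\sigma:[0,\infty)\to\mathcal P$ is a piecewise constant switching signal taking values in a finite set $\mathcal P$ of digraphs on $\mathcal V$; no arc of any of these digraphs enters a leader. An arc $(j,i)$ means that $i$ receives information from $j$. Dwell-time assumption: any two consecutive switching instants of $\sigma$ are separated by at least $\tau_D>0$. For $i\in\mathcal V_F$, $N_i(\sigma(t))=\{j\in\mathcal V_F:(j,i)\in\mathcal E_{\sigma(t)}\}$ and $L_i(\sigma(t))=\{j\in\mathcal V_L:(j,i)\in\mathcal E_{\sigma(t)}\}$. $\mathcal G^F_{\sigma(t)}$ denotes the subgraph of $\mathcal G_{\sigma(t)}$ induced on $\mathcal V_F$. For $0\le t_1<t_2\le\infty$ the joint graph is $\mathcal G([t_1,t_2))=(\mathcal V,\bigcup_{t\in[t_1,t_2)}\mathcal E_{\sigma(t)})$, and $\mathcal G^F([t_1,t_2))$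 is its subgraph induced on $\mathcal V_F$. System (5): $\dot y_i=u_i(y,t)$ for $i=1,\dots,k$, and $\dot x_i=\sum_{j\in N_i(\sigma(t))}a_{ij}(x,y,t)(x_j-x_i)+\sum_{j\in L_i(\sigma(t))}b_{ij}(x,y,t)(y_j-x_i)+w_i(t)$ for $i=1,\dots,n$, where $x_i,y_j\in\mathbb R^d$, $x=(x_1,\dots,x_n)$, $y=(y_1,\dots,y_k)$; each $u_i(y,t)$ is continuous in $y$ and piecewise continuous in $t$; each $w_i$ is continuous; the weights $a_{ij},b_{ij}$ are continuous and satisfy $a_*\le a_{ij}(x,y,t)\le a^*$, $b_{ij}(x,y,t)\ge b_*$ for all $x,y,t$, with constants $0<a_*\le a^*$, $b_*>0$. Initial time is $0$, $x^0=x(0)$, $y^0=y(0)$. Along a trajectory, $z(t)=(u_1(y(t),t),\dots,u_k(y(t),t),w_1(t),\dots,w_n(t))\in\mathbb R^{(n+k)d}$ and $\|z\|_\infty=\sup_{t\ge0}|z(t)|$. Set notation: $|\cdot|$ is the Euclidean norm; for a closed convex $K\subset\mathbb R^d$, $|v|_K=\inf_{p\in K}|v-p|$; $\mathcal L(y(t))=\mathrm{co}\{y_1(t),\dots,y_k(t)\}$ (convex hull); $|x(t)|_{\mathcal L(y(t))}=\max_{i\in\mathcal V_F}|x_i(t)|_{\mathcal L(y(t))}$. Connectivity: a digraph on $\mathcal V$ is L-connected if for every $i\in\mathcal V_F$ there is a directed path from some leader $j\in\mathcal V_L$ to $i$. $\mathcal G_{\sigma(t)}$ is jointly L-connected (JLC)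 if $\mathcal G([t,\infty))$ is L-connected for every $t\ge0$; it is uniformly jointly L-connected (UJLC) if there is $T>0$ such that $\mathcal G([t,t+T))$ is L-connected for every $t\ge0$. SiISS: system (5) is (globally, generalized) set integral-input-to-state stable with respect to $\mathcal L(y(t))$ if there exist a class-$\mathcal{KL}$ function $\beta$ and a class-$\mathcal K$ function $\gamma$ such that for all admissible $u_i,w_i$ and all initial conditions $x^0\in\mathbb R^{nd}$, $y^0\in\mathbb R^{kd}$: $|x(t)|_{\mathcal L(y(t))}\le\beta(|x^0|_{\mathcal L(y^0)},t)+\int_0^t\gamma(|z(s)|)\,ds$ for all $t\ge0$. *)

theory Defs
  imports "HOL-Analysis.Analysis"
begin

definition class_K :: "(real \<Rightarrow> real) \<Rightarrow> bool" where
  "class_K \<gamma> \<longleftrightarrow> continuous_on {0..} \<gamma> \<and> \<gamma> 0 = 0 \<and> strict_mono_on {0..} \<gamma>"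

definition class_KL :: "(real \<Rightarrow> real \<Rightarrow> real) \<Rightarrow> bool" where
  "class_KL \<beta> \<longleftrightarrow>
     continuous_on ({0..} \<times> {0..}) (\<lambda>(r, t). \<beta> r t) \<and>
     (\<forall>t\<ge>0. class_K (\<lambda>r. \<beta> r t)) \<and>
     (\<forall>r\<ge>0. (\<forall>s t. 0 \<le> s \<longrightarrow> s \<le> t \<longrightarrow> \<beta> r t \<le> \<beta> r s) \<and>
              ((\<lambda>t. \<beta> r t) \<longlongrightarrow> 0) at_top)"

text \<open>Vertices are of type 'n + 'k: Inl i is follower i, Inr j is leader j.
  An arc (p, q) means that q receives information from p.\<close>

definition joint_graph :: "(real \<Rightarrow> ('n + 'k) rel) \<Rightarrow> real set \<Rightarrow> ('n + 'k) rel" where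
  "joint_graph \<sigma> I = (\<Union>t\<in>I. \<sigma> t)"

definition follower_subgraph :: "('n + 'k) rel \<Rightarrow> ('n + 'k) rel" where
  "follower_subgraph E = {(p, q) \<in> E. p \<in> range Inl \<and> q \<in> range Inl}"

definition L_connected :: "('n + 'k) rel \<Rightarrow> bool" where
  "L_connected E \<longleftrightarrow> (\<forall>i. \<exists>j. (Inr j, Inl i) \<in> E\<^sup>+)"

definition JLC :: "(real \<Rightarrow> ('n + 'k) rel) \<Rightarrow> bool" where
  "JLC \<sigma> \<longleftrightarrow> (\<forall>t\<ge>0. L_connected (joint_graph \<sigma> {t..}))"

definition dwell_time_signal :: "(real \<Rightarrow> 'a) \<Rightarrow> real \<Rightarrow> bool" where
  "dwell_time_signal \<sigma> \<tau> \<longleftrightarrow> \<tau> > 0 \<and>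
     (\<exists>S. S \<subseteq> {0<..} \<and> (\<forall>s\<in>S. \<forall>s'\<in>S. s \<noteq> s' \<longrightarrow> \<tau> \<le> \<bar>s - s'\<bar>) \<and>
        (\<forall>a b. 0 \<le> a \<longrightarrow> a < b \<longrightarrow> {a<..<b} \<inter> S = {} \<longrightarrow> (\<forall>t\<in>{a..<b}. \<sigma> t = \<sigma> a)))"

definition N_set :: "('n + 'k) rel \<Rightarrow> 'n \<Rightarrow> 'n set" where
  "N_set E i = {j. (Inl j, Inl i) \<in> E}"

definition L_set :: "('n + 'k) rel \<Rightarrow> 'n \<Rightarrow> 'k set" where
  "L_set E i = {j. (Inr j, Inl i) \<in> E}"

definition follower_rhs ::
  "(real \<Rightarrow> ('n::finite + 'k::finite) rel) \<Rightarrow>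
   ('n \<Rightarrow> 'n \<Rightarrow> real^'d^'n \<Rightarrow> real^'d^'k \<Rightarrow> real \<Rightarrow> real) \<Rightarrow>
   ('n \<Rightarrow> 'k \<Rightarrow> real^'d^'n \<Rightarrow> real^'d^'k \<Rightarrow> real \<Rightarrow> real) \<Rightarrow>
   (real \<Rightarrow> real^'d::finite^'n) \<Rightarrow> real^'d^'n \<Rightarrow> real^'d^'k \<Rightarrow> real \<Rightarrow> real^'d^'n" where
  "follower_rhs \<sigma> a b w x y t = (\<chi> i.
      (\<Sum>j\<in>N_set (\<sigma> t) i. a i j x y t *\<^sub>R (x $ j - x $ i))
    + (\<Sum>j\<in>L_set (\<sigma> t) i. b i j x y t *\<^sub>R (y $ j - x $ i))
    + w t $ i)"

text \<open>Solutions on [0,inf) in integral (Caratheodory) form, which covers the piecewise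
  continuous right-hand sides of system (5).\<close>

definition sys5_solution ::
  "(real \<Rightarrow> ('n::finite + 'k::finite) rel) \<Rightarrow>
   ('n \<Rightarrow> 'n \<Rightarrow> real^'d^'n \<Rightarrow> real^'d^'k \<Rightarrow> real \<Rightarrow> real) \<Rightarrow>
   ('n \<Rightarrow> 'k \<Rightarrow> real^'d^'n \<Rightarrow> real^'d^'k \<Rightarrow> real \<Rightarrow> real) \<Rightarrow>
   (real^'d::finite^'k \<Rightarrow> real \<Rightarrow> real^'d^'k) \<Rightarrow> (real \<Rightarrow> real^'d^'n) \<Rightarrow>
   (real \<Rightarrow> real^'d^'n) \<Rightarrow> (real \<Rightarrow> real^'d^'k) \<Rightarrow> bool" where
  "sys5_solution \<sigma> a b u w x y \<longleftrightarrow>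
     (\<forall>t\<ge>0. ((\<lambda>s. u (y s) s) has_integral (y t - y 0)) {0..t} \<and>
            ((\<lambda>s. follower_rhs \<sigma> a b w (x s) (y s) s) has_integral (x t - x 0)) {0..t})"

definition piecewise_cont_nonneg :: "(real \<Rightarrow> 'a::real_normed_vector) \<Rightarrow> bool" where
  "piecewise_cont_nonneg f \<longleftrightarrow>
     (\<forall>c\<ge>0. \<exists>D. finite D \<and> continuous_on ({0..c} - D) f \<and>
        (\<forall>s\<in>{0..c}. (\<exists>l. (f \<longlongrightarrow> l) (at s within {0..<s})) \<and>
                      (\<exists>l. (f \<longlongrightarrow> l) (at s within {s<..c}))))"

definition admissible_inputs ::
  "(real^'d::finite^'k::finite \<Rightarrow> real \<Rightarrow> real^'d^'k) \<Rightarrow> (real \<Rightarrow> real^'d^'n::finite) \<Rightarrow> bool" where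
  "admissible_inputs u w \<longleftrightarrow>
     (\<forall>t\<ge>0. continuous_on UNIV (\<lambda>y. u y t)) \<and>
     (\<forall>y. piecewise_cont_nonneg (\<lambda>t. u y t)) \<and>
     continuous_on {0..} w"

definition leader_hull :: "real^'d::finite^'k::finite \<Rightarrow> (real^'d) set" where
  "leader_hull y = convex hull (range (\<lambda>j. y $ j))"

definition dist_L :: "real^'d::finite^'n::finite \<Rightarrow> real^'d^'k::finite \<Rightarrow> real" where
  "dist_L x y = Max (range (\<lambda>i. infdist (x $ i) (leader_hull y)))"

text \<open>SiISS w.r.t. L(y(t)); the integral of gamma(|z|) is the nonnegative Lebesgue integral
  (possibly infinite), z(s) = (u(y(s),s), w(s)) with the Euclidean norm on R^((n+k)d).\<close>

definition SiISS ::
  "(real \<Rightarrow> ('n::finite + 'k::finite) rel) \<Rightarrow>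
   ('n \<Rightarrow> 'n \<Rightarrow> real^'d::finite^'n \<Rightarrow> real^'d^'k \<Rightarrow> real \<Rightarrow> real) \<Rightarrow>
   ('n \<Rightarrow> 'k \<Rightarrow> real^'d^'n \<Rightarrow> real^'d^'k \<Rightarrow> real \<Rightarrow> real) \<Rightarrow> bool" where
  "SiISS \<sigma> a b \<longleftrightarrow>
    (\<exists>\<beta> \<gamma>. class_KL \<beta> \<and> class_K \<gamma> \<and>
      (\<forall>u w x y. admissible_inputs u w \<longrightarrow> sys5_solution \<sigma> a b u w x y \<longrightarrow>
        (\<forall>t\<ge>0. ennreal (dist_L (x t) (y t)) \<le>
            ennreal (\<beta> (dist_L (x 0) (y 0)) t)
            + set_nn_integral lborel {0..t} (\<lambda>s. ennreal (\<gamma> (norm (u (y s) s, w s)))))))"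

end

theory Submission
  imports Defs "HOL-Complex_Analysis.Great_Picard"
begin

text \<open>
  Sufficiency. Fix a final time \<open>t\<close> and let \<open>e\<close> be the outward unit normal of the leader hull at the
  point closest to \<open>x\<^sub>i(t)\<close>. With \<open>U\<close>, \<open>W\<close> the integrals of the norms of the leader and follower
  inputs, the scalar \<open>G(s) = e \<bullet> x\<^sub>i(s) - h(t) - U(t) - W(s)\<close> cannot increase while it exceeds a bound
  \<open>R\<close> for the (input-corrected) distances of the in-neighbours of \<open>i\<close>, and drops at a definite rate
  while it exceeds \<open>R + \<eta>\<close> and \<open>i\<close> receives anything. Joint connectivity and the dwell time provide
  infinitely many active windows of a fixed length, so induction along the acyclic follower graph
  shows that the distance is eventually at most \<open>\<epsilon>\<close> times its initial value plus \<open>U + W\<close>, uniformly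
  over all solutions. A continuous decreasing envelope of these rates gives
  \<open>\<beta>(r, t) = r B(t)\<close>, and \<open>\<gamma>(s) = 2 s\<close>.

  Necessity. If after time \<open>t\<^sub>0\<close> the followers in \<open>A\<close> are unreachable from the leaders, keep all
  leaders at 0, use zero inputs and start all followers at \<open>(1, \<dots>, 1)\<close>. Coordinates are at least
  \<open>exp (- K t\<^sub>0)\<close> at time \<open>t\<^sub>0\<close> and, inside \<open>A\<close>, never fall below this value afterwards. As the
  weights are merely continuous, the solution comes from Peano's theorem.
\<close>

section \<open>Barriers and decay of scalar functions\<close>

text \<open>The crossing is the largest point of the compact sublevel set of \<open>c\<close>; the
  intermediate value theorem forces equality there.\<close>

lemma last_crossing:
  fixes f :: "real \<Rightarrow> real"
  assumes cont: "continuous_on {a..b} f" and "a \<le> b" and fa: "f a \<le> c" and fb: "c < f b"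
  obtains s where "a \<le> s" "s < b" "f s = c" "\<And>r. s \<le> r \<Longrightarrow> r \<le> b \<Longrightarrow> c \<le> f r"
proof -
  define K where "K = {r \<in> {a..b}. f r \<le> c}"
  have "closed K"
    unfolding K_def by (intro continuous_on_closed_Collect_le cont continuous_intros)
  moreover have "bounded K"
    by (rule bounded_subset[of "{a..b}"]) (auto simp: K_def)
  ultimately have "compact K"
    by (simp add: compact_eq_bounded_closed)
  moreover have "a \<in> K" using assms by (auto simp: K_def)
  ultimately obtain s where s: "s \<in> K" "\<And>r. r \<in> K \<Longrightarrow> r \<le> s"
    using compact_attains_sup[of K] by blast
  have ab: "a \<le> s" "s \<le> b" "f s \<le> c" using s(1) by (auto simp: K_def)
  have "s \<noteq> b" using ab(3) fb by auto
  have above: "c < f r" if "s < r" "r \<le> b" for r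
    using s(2)[of r] that ab by (force simp: K_def)
  have "continuous_on {s..b} f"
    using cont by (rule continuous_on_subset) (use ab in auto)
  then obtain z where z: "s \<le> z" "z \<le> b" "f z = c"
    using IVT'[of f s c b] ab fb by auto
  then have "z = s" using above[of z] by force
  show ?thesis
  proof (rule that)
    show "c \<le> f r" if "s \<le> r" "r \<le> b" for r
      using above[of r] that z \<open>z = s\<close> by (cases "r = s") auto
  qed (use ab \<open>s \<noteq> b\<close> z \<open>z = s\<close> in auto)
qed

text \<open>After the last crossing of \<open>c\<close> the function stays above \<open>c\<close>,
  so a decrease is demanded only on final stretches where the barrier is exceeded. This serves in
  place of a differential comparison argument, since solutions are given in integral form.\<close>

lemma barrier:
  fixes f :: "real \<Rightarrow> real"
  assumes "continuous_on {a..b} f" "a \<le> b" "f a \<le> c"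
    and dec: "\<And>s. a \<le> s \<Longrightarrow> s \<le> b \<Longrightarrow> (\<And>r. s \<le> r \<Longrightarrow> r \<le> b \<Longrightarrow> c \<le> f r) \<Longrightarrow> f b \<le> f s"
  shows "f b \<le> c"
proof (rule ccontr)
  assume "\<not> f b \<le> c"
  then obtain s where "a \<le> s" "s < b" "f s = c" "\<And>r. s \<le> r \<Longrightarrow> r \<le> b \<Longrightarrow> c \<le> f r"
    using last_crossing[OF assms(1-3)] by (metis not_le)
  then show False using dec[of s] \<open>\<not> f b \<le> c\<close> by auto
qed

text \<open>\<open>B t\<close> is the supremum of \<open>\<rho> s\<close> over all
  \<open>s \<ge> 0\<close>, where values at \<open>s \<ge> t\<close> count fully and earlier ones
  fade exponentially. The weight decreases in \<open>t\<close>, but no faster than exponentially, so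
  \<open>B\<close> is decreasing and Lipschitz.\<close>

lemma decreasing_continuous_envelope:
  fixes \<rho> :: "real \<Rightarrow> real"
  assumes pos: "\<And>t. 0 \<le> t \<Longrightarrow> 0 < \<rho> t" and bdd: "\<And>t. 0 \<le> t \<Longrightarrow> \<rho> t \<le> M"
    and lim: "(\<rho> \<longlongrightarrow> 0) at_top"
  obtains B where "continuous_on UNIV B" "antimono B" "(B \<longlongrightarrow> 0) at_top"
    "\<And>t. 0 \<le> t \<Longrightarrow> \<rho> t \<le> B t" "\<And>t. 0 < B t"
proof -
  define k where "k t s = \<rho> s * exp (- max 0 (t - s))" for t s
  define B where "B t = (SUP s\<in>{0..}. k t s)" for t
  have kM: "k t s \<le> M" if "0 \<le> s" for t s
  proof -
    have "k t s \<le> \<rho> s * 1" unfolding k_def using pos[OF that] by (intro mult_left_mono) auto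
    then show ?thesis using bdd[OF that] by simp
  qed
  have bA: "bdd_above (k t ` {0..})" for t using kM by (intro bdd_aboveI2[of _ _ M]) auto
  have le: "k t s \<le> B t" if "0 \<le> s" for t s
    unfolding B_def using that by (intro cSUP_upper bA) auto
  have least: "B t \<le> c" if "\<And>s. 0 \<le> s \<Longrightarrow> k t s \<le> c" for t c
    unfolding B_def using that by (intro cSUP_least) auto
  have kpos: "0 < k t s" if "0 \<le> s" for t s using pos[OF that] by (simp add: k_def)
  have Bpos: "0 < B t" for t using le[of 0 t] kpos[of 0 t] by simp
  have anti: "B t' \<le> B t" if "t \<le> t'" for t t'
  proof (rule least)
    fix s :: real assume "0 \<le> s"
    then have "k t' s \<le> k t s" unfolding k_def using that pos[of s]
      by (intro mult_left_mono) auto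
    then show "k t' s \<le> B t" using le[OF \<open>0 \<le> s\<close>, of t] by simp
  qed
  \<comment> \<open>Passing from \<open>t\<close> to \<open>t'\<close> costs each weight at most the
    factor \<open>exp (t - t')\<close>. With \<open>B \<le> M\<close> this becomes the Lipschitz
    bound.\<close>
  have low: "exp (t - t') * B t \<le> B t'" if "t \<le> t'" for t t'
  proof -
    have "B t \<le> exp (t' - t) * B t'"
    proof (rule least)
      fix s :: real assume "0 \<le> s"
      have "exp (- max 0 (t - s)) \<le> exp ((t' - t) + - max 0 (t' - s))"
        using that by simp
      then have "\<rho> s * exp (- max 0 (t - s)) \<le> \<rho> s * exp ((t' - t) + - max 0 (t' - s))"
        using pos[OF \<open>0 \<le> s\<close>] by (intro mult_left_mono) auto
      then have "k t s \<le> exp (t' - t) * k t' s"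
        unfolding k_def exp_add by (simp only: mult.left_commute)
      also have "\<dots> \<le> exp (t' - t) * B t'" using le[OF \<open>0 \<le> s\<close>, of t'] by simp
      finally show "k t s \<le> exp (t' - t) * B t'" .
    qed
    then have "exp (t - t') * B t \<le> exp (t - t') * (exp (t' - t) * B t')" by simp
    also have "\<dots> = B t'" by (simp add: exp_add[symmetric] mult.assoc[symmetric])
    finally show ?thesis .
  qed
  have BM: "B t \<le> M" for t using kM by (intro least) auto
  have lip: "\<bar>B t - B t'\<bar> \<le> M * \<bar>t - t'\<bar>" if "t \<le> t'" for t t'
  proof -
    have "B t - B t' \<le> (1 - exp (t - t')) * B t" using low[OF that] by (simp add: algebra_simps)
    also have "\<dots> \<le> (t' - t) * B t"
    proof (intro mult_right_mono)
      show "1 - exp (t - t') \<le> t' - t" using exp_ge_add_one_self[of "t - t'"] by linarith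
    qed (use Bpos[of t] in auto)
    also have "\<dots> \<le> (t' - t) * M" using BM that by (intro mult_left_mono) auto
    finally show ?thesis using anti[OF that] that by (simp add: mult.commute[of M])
  qed
  have "M-lipschitz_on UNIV B"
  proof (rule lipschitz_onI)
    show "dist (B t) (B t') \<le> M * dist t t'" for t t'
      using lip[of t t'] lip[of t' t] by (cases "t \<le> t'") (auto simp: dist_real_def abs_minus_commute)
    show "0 \<le> M" using pos[of 0] bdd[of 0] by simp
  qed
  then have cont: "continuous_on UNIV B" by (rule lipschitz_on_continuous_on)
  have "(B \<longlongrightarrow> 0) at_top"
  proof (rule order_tendstoI)
    fix c :: real assume "c < 0"
    then show "\<forall>\<^sub>F t in at_top. c < B t" using Bpos by (intro always_eventually allI) (meson less_trans)
  next
    fix c :: real assume c: "0 < c"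
    obtain T where T: "\<And>s. T \<le> s \<Longrightarrow> \<rho> s < c / 2"
      using order_tendstoD(2)[OF lim, of "c/2"] c by (auto simp: eventually_at_top_linorder)
    define T' where "T' = max 0 T"
    \<comment> \<open>Beyond this threshold, obtained from \<open>1 + v \<le> exp v\<close>, the
      early values \<open>s < T'\<close> contribute at most \<open>c / 2\<close>; the later ones are
      small by the choice of \<open>T\<close>.\<close>
    have "M * exp (- (t - T')) \<le> c / 2" if "T' + 2 * M / c \<le> t" for t
    proof -
      have "2 * M / c \<le> exp (t - T')" using exp_ge_add_one_self[of "t - T'"] that by linarith
      then have "M \<le> c / 2 * exp (t - T')" using c by (simp add: field_simps)
      then have "M * exp (- (t - T')) \<le> c / 2 * exp (t - T') * exp (- (t - T'))"
        by (intro mult_right_mono) auto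
      also have "\<dots> = c / 2" by (simp only: mult.assoc exp_add[symmetric]) simp
      finally show ?thesis .
    qed
    then have "\<forall>\<^sub>F t in at_top. M * exp (- (t - T')) \<le> c / 2"
      unfolding eventually_at_top_linorder by blast
    moreover have "\<forall>\<^sub>F t in at_top. T' \<le> t" by (rule eventually_ge_at_top)
    ultimately show "\<forall>\<^sub>F t in at_top. B t < c"
    proof eventually_elim
      case (elim t)
      have "B t \<le> c / 2"
      proof (rule least)
        fix s :: real assume s: "0 \<le> s"
        show "k t s \<le> c / 2"
        proof (cases "T' \<le> s")
          case True
          have "k t s \<le> \<rho> s * 1" unfolding k_def using pos[OF s] by (intro mult_left_mono) auto
          then show ?thesis using T[of s] True by (simp add: T'_def)
        next
          case False
          have "k t s \<le> M * exp (- (t - T'))" unfolding k_def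
            using pos[OF s] bdd[OF s] False elim by (intro mult_mono) auto
          then show ?thesis using elim by simp
        qed
      qed
      then show ?case using c by simp
    qed
  qed
  moreover have "\<rho> t \<le> B t" if "0 \<le> t" for t using le[OF that, of t] by (simp add: k_def)
  moreover have "antimono B" by (rule antimonoI) (rule anti)
  ultimately show ?thesis using that cont Bpos by blast
qed

text \<open>The least admissible \<open>\<epsilon>\<close> at time \<open>t\<close> may be zero or
  not attained. Adding \<open>exp (- t)\<close> makes the rate positive and strictly larger than the
  infimum, hence admissible by \<open>mono\<close>, without spoiling the limit.\<close>

lemma decay_rate_envelope:
  fixes Q :: "real \<Rightarrow> real \<Rightarrow> bool"
  assumes one: "\<And>t. 0 \<le> t \<Longrightarrow> Q 1 t"
    and small: "\<And>\<epsilon>. 0 < \<epsilon> \<Longrightarrow> \<exists>T. \<forall>t\<ge>T. Q \<epsilon> t"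
    and mono: "\<And>\<epsilon> \<epsilon>' t. Q \<epsilon> t \<Longrightarrow> \<epsilon> \<le> \<epsilon>' \<Longrightarrow> Q \<epsilon>' t"
  obtains B where "continuous_on UNIV B" "antimono B" "(B \<longlongrightarrow> 0) at_top"
    "\<forall>t. 0 < B t" "\<forall>t\<ge>0. Q (B t) t"
proof -
  define \<rho> where "\<rho> t = Inf {\<epsilon>. 0 \<le> \<epsilon> \<and> Q \<epsilon> t} + exp (- t)" for t
  have bdd: "bdd_below {\<epsilon>. 0 \<le> \<epsilon> \<and> Q \<epsilon> t}" for t by (rule bdd_belowI[of _ 0]) auto
  have Inf_le: "Inf {\<epsilon>. 0 \<le> \<epsilon> \<and> Q \<epsilon> t} \<le> \<epsilon>" if "0 \<le> \<epsilon>" "Q \<epsilon> t" for \<epsilon> t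
    using that by (intro cInf_lower bdd) auto
  have Inf_ge: "0 \<le> Inf {\<epsilon>. 0 \<le> \<epsilon> \<and> Q \<epsilon> t}" if "0 \<le> t" for t
    using one[OF that] by (intro cInf_greatest) (auto intro!: exI[of _ 1])
  have Q\<rho>: "Q (\<rho> t) t" if t: "0 \<le> t" for t
  proof -
    have "Inf {\<epsilon>. 0 \<le> \<epsilon> \<and> Q \<epsilon> t} < \<rho> t" by (simp add: \<rho>_def)
    then obtain \<epsilon> where "Q \<epsilon> t" "\<epsilon> < \<rho> t"
      using cInf_lessD[of "{\<epsilon>. 0 \<le> \<epsilon> \<and> Q \<epsilon> t}" "\<rho> t"] one[OF t] zero_le_one by blast
    then show ?thesis using mono less_imp_le by blast
  qed
  have pos: "0 < \<rho> t" if "0 \<le> t" for t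
    using Inf_ge[OF that] by (simp add: \<rho>_def add_nonneg_pos)
  have "\<rho> t \<le> 2" if "0 \<le> t" for t
  proof -
    have "exp (- t) \<le> 1" using that by simp
    then show ?thesis using Inf_le[OF _ one[OF that]] unfolding \<rho>_def by linarith
  qed
  moreover have "(\<rho> \<longlongrightarrow> 0) at_top"
  proof (rule order_tendstoI)
    fix c :: real assume "c < 0"
    then show "\<forall>\<^sub>F t in at_top. c < \<rho> t"
      unfolding eventually_at_top_linorder using pos less_trans by blast
  next
    fix c :: real assume c: "0 < c"
    then obtain T where T: "\<forall>t\<ge>T. Q (c/2) t" using small[of "c/2"] by auto
    have "((\<lambda>t::real. exp (- t)) \<longlongrightarrow> 0) at_top"
      by (rule filterlim_compose[OF exp_at_bot filterlim_uminus_at_bot_at_top])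
    then have "\<forall>\<^sub>F t in at_top. exp (- t :: real) < c / 2"
      using order_tendstoD(2) c half_gt_zero by blast
    moreover have "\<forall>\<^sub>F t in at_top. T \<le> t" by (rule eventually_ge_at_top)
    ultimately show "\<forall>\<^sub>F t in at_top. \<rho> t < c"
    proof eventually_elim
      case (elim t)
      then show ?case using Inf_le[of "c/2" t] T c by (simp add: \<rho>_def)
    qed
  qed
  ultimately obtain B where B: "continuous_on UNIV B" "antimono B" "(B \<longlongrightarrow> 0) at_top"
    "\<And>t. 0 \<le> t \<Longrightarrow> \<rho> t \<le> B t" "\<And>t. 0 < B t"
    using decreasing_continuous_envelope[of \<rho> 2] pos by blast
  moreover have "Q (B t) t" if "0 \<le> t" for t using Q\<rho>[OF that] B(4)[OF that] by (rule mono)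
  ultimately show ?thesis using that by blast
qed

text \<open>Windows satisfying \<open>P\<close> are picked one after another, each after the
  previous one has ended, and each lowers \<open>G\<close> by \<open>\<kappa>\<close> until the
  floor \<open>lev\<close> is reached. The time \<open>T'\<close> is chosen before \<open>G\<close>,
  \<open>t\<close>, \<open>lev\<close> and \<open>\<kappa>\<close>, which makes the later decay
  times uniform over all trajectories.\<close>

lemma iterated_contraction:
  fixes P :: "real \<Rightarrow> bool"
  assumes "0 \<le> \<delta>" and P: "\<And>T. \<exists>p\<ge>T. P p"
  shows "\<exists>T'\<ge>T. \<forall>G t lev \<kappa>. T' \<le> t \<longrightarrow> 0 \<le> \<kappa> \<longrightarrow>
     (\<forall>s1 s2 c. T \<le> s1 \<longrightarrow> s1 \<le> s2 \<longrightarrow> s2 \<le> t \<longrightarrow> lev \<le> c \<longrightarrow> G s1 \<le> c \<longrightarrow> G s2 \<le> c) \<longrightarrow>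
     (\<forall>p\<ge>T. P p \<longrightarrow> p + \<delta> \<le> t \<longrightarrow> G (p + \<delta>) \<le> max lev (G p - \<kappa>)) \<longrightarrow>
     G T' \<le> max lev (G T - real N * \<kappa> :: real)"
proof (induction N)
  case 0
  show ?case by (rule exI[of _ T]) auto
next
  case (Suc N)
  then obtain T1 where T1: "T \<le> T1" and IH: "\<forall>G t lev \<kappa>. T1 \<le> t \<longrightarrow> 0 \<le> \<kappa> \<longrightarrow>
     (\<forall>s1 s2 c. T \<le> s1 \<longrightarrow> s1 \<le> s2 \<longrightarrow> s2 \<le> t \<longrightarrow> lev \<le> c \<longrightarrow> G s1 \<le> c \<longrightarrow> G s2 \<le> c) \<longrightarrow>
     (\<forall>p\<ge>T. P p \<longrightarrow> p + \<delta> \<le> t \<longrightarrow> G (p + \<delta>) \<le> max lev (G p - \<kappa>)) \<longrightarrow>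
     G T1 \<le> max lev (G T - real N * \<kappa>)"
    by (elim exE conjE) (rule that)
  obtain p where p: "T1 \<le> p" "P p" using P by blast
  show ?case
  proof (intro exI[of _ "p + \<delta>"] conjI allI impI)
    show "T \<le> p + \<delta>" using T1 p \<open>0 \<le> \<delta>\<close> by linarith
    fix G :: "real \<Rightarrow> real" and t lev \<kappa> :: real
    assume t: "p + \<delta> \<le> t" and \<kappa>: "0 \<le> \<kappa>"
      and inv: "\<forall>s1 s2 c. T \<le> s1 \<longrightarrow> s1 \<le> s2 \<longrightarrow> s2 \<le> t \<longrightarrow> lev \<le> c \<longrightarrow> G s1 \<le> c \<longrightarrow> G s2 \<le> c"
      and con: "\<forall>p\<ge>T. P p \<longrightarrow> p + \<delta> \<le> t \<longrightarrow> G (p + \<delta>) \<le> max lev (G p - \<kappa>)"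
    have "G T1 \<le> max lev (G T - real N * \<kappa>)"
      using inv con t p \<kappa> \<open>0 \<le> \<delta>\<close> by (intro IH[THEN spec[of _ G], THEN spec[of _ t], rule_format]) auto
    \<comment> \<open>No bound is lost while waiting for the next window.\<close>
    then have "G p \<le> max lev (G T - real N * \<kappa>)"
      using inv[rule_format, of T1 p "max lev (G T - real N * \<kappa>)"] p T1 t \<open>0 \<le> \<delta>\<close> by auto
    moreover have "G (p + \<delta>) \<le> max lev (G p - \<kappa>)"
      using con p T1 t by auto
    ultimately show "G (p + \<delta>) \<le> max lev (G T - real (Suc N) * \<kappa>)"
      using \<kappa> by (simp only: of_nat_Suc distrib_right)
  qed
qed

section \<open>Dwell time\<close>

text \<open>Without a switch in the half dwell time after \<open>t\<close>, the window starts at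
  \<open>t\<close>. Otherwise the switch \<open>s\<close> found there is preceded by a switch-free
  interval of length \<open>\<tau>\<close> containing \<open>t\<close>, and the window starts at
  \<open>s - \<tau>\<close>.\<close>

lemma dwell_time_persistence:
  assumes "dwell_time_signal \<sigma> \<tau>" "\<tau> \<le> t"
  obtains p where "t - \<tau> \<le> p" "\<And>s. p \<le> s \<Longrightarrow> s \<le> p + \<tau> / 4 \<Longrightarrow> \<sigma> s = \<sigma> t"
proof -
  obtain S where \<tau>: "\<tau> > 0"
    and sep: "\<And>s s'. s \<in> S \<Longrightarrow> s' \<in> S \<Longrightarrow> s \<noteq> s' \<Longrightarrow> \<tau> \<le> \<bar>s - s'\<bar>"
    and const: "\<And>a b r. 0 \<le> a \<Longrightarrow> a < b \<Longrightarrow> {a<..<b} \<inter> S = {} \<Longrightarrow> r \<in> {a..<b} \<Longrightarrow> \<sigma> r = \<sigma> a"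
    using assms(1) unfolding dwell_time_signal_def by metis
  show ?thesis
  proof (cases "{t<..<t + \<tau> / 2} \<inter> S = {}")
    case True
    show ?thesis
    proof (rule that[of t])
      show "\<sigma> s = \<sigma> t" if "t \<le> s" "s \<le> t + \<tau> / 4" for s
        by (rule const[of t "t + \<tau> / 2" s]) (use True that \<tau> assms(2) in auto)
    qed (use \<tau> in auto)
  next
    case False
    then obtain s where s: "s \<in> S" "t < s" "s < t + \<tau> / 2" by auto
    have "{s - \<tau><..<s} \<inter> S = {}" using sep[OF s(1)] by force
    then have *: "\<sigma> r = \<sigma> (s - \<tau>)" if "s - \<tau> \<le> r" "r < s" for r
      by (intro const[of "s - \<tau>" s r]) (use that \<tau> assms(2) s in auto)
    show ?thesis
    proof (rule that[of "s - \<tau>"])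
      show "\<sigma> r = \<sigma> t" if "s - \<tau> \<le> r" "r \<le> s - \<tau> + \<tau> / 4" for r
        by (rule trans[OF *[of r] *[of t, symmetric]]) (use that s \<tau> in auto)
    qed (use s in auto)
  qed
qed

lemma dwell_time_right_constant:
  assumes "dwell_time_signal \<sigma> \<tau>" "0 \<le> t"
  obtains \<delta> where "\<delta> > 0" "\<And>s. t \<le> s \<Longrightarrow> s < t + \<delta> \<Longrightarrow> \<sigma> s = \<sigma> t"
proof -
  obtain S where \<tau>: "\<tau> > 0"
    and sep: "\<And>s s'. s \<in> S \<Longrightarrow> s' \<in> S \<Longrightarrow> s \<noteq> s' \<Longrightarrow> \<tau> \<le> \<bar>s - s'\<bar>"
    and const: "\<And>a b r. 0 \<le> a \<Longrightarrow> a < b \<Longrightarrow> {a<..<b} \<inter> S = {} \<Longrightarrow> r \<in> {a..<b} \<Longrightarrow> \<sigma> r = \<sigma> a"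
    using assms(1) unfolding dwell_time_signal_def by metis
  show ?thesis
  proof (cases "{t<..<t + \<tau>} \<inter> S = {}")
    case True
    show ?thesis
      by (rule that[OF \<tau>], rule const[of t "t + \<tau>"]) (use True \<tau> assms(2) in auto)
  next
    case False
    then obtain s where s: "s \<in> S" "t < s" "s < t + \<tau>" by auto
    have "{t<..<s} \<inter> S = {}" using sep[OF s(1)] s by force
    then show ?thesis
      by (intro that[of "s - t"] const[of t s]) (use s assms(2) in auto)
  qed
qed

text \<open>The signal is right-constant, so the indicator of the set at \<open>t\<close> is the
  limit of its values at the next grid points \<open>r n t\<close>, which lie to the right of
  \<open>t\<close>. Each approximant depends on \<open>t\<close> only through an integer part and
  the sign of \<open>t\<close>.\<close>

lemma dwell_time_measurable:
  assumes "dwell_time_signal \<sigma> \<tau>"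
  shows "{t. 0 \<le> t \<and> \<sigma> t = c} \<in> sets borel"
proof -
  define r :: "nat \<Rightarrow> real \<Rightarrow> real" where "r n t = real_of_int (\<lfloor>t * Suc n\<rfloor> + 1) / Suc n" for n t
  define \<phi> :: "real \<Rightarrow> real" where "\<phi> t = (if 0 \<le> t \<and> \<sigma> t = c then 1 else 0)" for t
  have r_bounds: "t < r n t" "r n t \<le> t + 1 / Suc n" for t n
  proof -
    have "t * Suc n < real_of_int (\<lfloor>t * Suc n\<rfloor> + 1)" "real_of_int (\<lfloor>t * Suc n\<rfloor> + 1) \<le> t * Suc n + 1"
      by linarith+
    then show "t < r n t" "r n t \<le> t + 1 / Suc n"
      unfolding r_def by (simp_all add: pos_less_divide_eq pos_divide_le_eq distrib_right
        del: of_nat_Suc of_int_add)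
  qed
  have lim: "(\<lambda>n. if 0 \<le> t then \<phi> (r n t) else 0) \<longlonglongrightarrow> \<phi> t" for t
  proof (cases "0 \<le> t")
    case True
    obtain \<delta> where \<delta>: "\<delta> > 0" "\<And>s. t \<le> s \<Longrightarrow> s < t + \<delta> \<Longrightarrow> \<sigma> s = \<sigma> t"
      using dwell_time_right_constant[OF assms True] by blast
    have "\<forall>\<^sub>F n in sequentially. 1 / real (Suc n) < \<delta>"
      using order_tendstoD(2)[OF LIMSEQ_inverse_real_of_nat \<delta>(1)] by (simp add: inverse_eq_divide)
    then have "\<forall>\<^sub>F n in sequentially. \<phi> (r n t) = \<phi> t"
    proof eventually_elim
      case (elim n)
      then have "\<sigma> (r n t) = \<sigma> t" using r_bounds(1)[of t n] r_bounds(2)[of n t] \<delta>(2)[of "r n t"] by linarith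
      then show ?case using True r_bounds(1)[of t n] by (auto simp: \<phi>_def)
    qed
    then show ?thesis using True by (auto intro: tendsto_eventually)
  qed (simp add: \<phi>_def)
  have "(\<lambda>t. if 0 \<le> t then \<phi> (r n t) else 0) \<in> borel_measurable borel" for n
  proof -
    have "(\<lambda>t. \<lfloor>t * real (Suc n)\<rfloor>) \<in> measurable borel (count_space UNIV)"
      by measurable
    then have "(\<lambda>t. (\<lambda>k. \<phi> (real_of_int (k + 1) / Suc n)) \<lfloor>t * real (Suc n)\<rfloor>) \<in> borel_measurable borel"
      by (rule measurable_compose) simp
    then have "(\<lambda>t. \<phi> (r n t)) \<in> borel_measurable borel" by (simp add: r_def)
    then show ?thesis by measurable
  qed
  then have "\<phi> \<in> borel_measurable borel"
    by (rule borel_measurable_LIMSEQ_real[OF lim])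
  then have "\<phi> -` {1} \<inter> space borel \<in> sets borel"
    by (rule measurable_sets) auto
  moreover have "\<phi> -` {1} \<inter> space borel = {t. 0 \<le> t \<and> \<sigma> t = c}"
    by (auto simp: \<phi>_def split: if_splits)
  ultimately show ?thesis by simp
qed

section \<open>Indefinite integrals\<close>

lemma has_integral_increment:
  fixes f :: "real \<Rightarrow> 'a::banach"
  assumes "\<And>t. 0 \<le> t \<Longrightarrow> (f has_integral (g t - g 0)) {0..t}" "0 \<le> s1" "s1 \<le> s2"
  shows "(f has_integral (g s2 - g s1)) {s1..s2}"
proof -
  have "f integrable_on {0..s2}" using assms(1)[of s2] assms(2,3) by (auto simp: integrable_on_def)
  then have "f integrable_on {s1..s2}"
    by (rule integrable_subinterval_real) (use assms in auto)
  moreover have "integral {0..s1} f + integral {s1..s2} f = integral {0..s2} f"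
    using assms \<open>f integrable_on {0..s2}\<close> by (intro Henstock_Kurzweil_Integration.integral_combine) auto
  moreover have "integral {0..s1} f = g s1 - g 0" "integral {0..s2} f = g s2 - g 0"
    using assms by (auto intro!: integral_unique)
  ultimately show ?thesis by (simp add: has_integral_iff algebra_simps)
qed

lemma has_integral_imp_continuous_on:
  fixes f :: "real \<Rightarrow> 'a::banach"
  assumes "\<And>t. 0 \<le> t \<Longrightarrow> (f has_integral (g t - g 0)) {0..t}"
  shows "continuous_on {0..t} g"
proof (cases "0 \<le> t")
  case True
  have "continuous_on {0..t} (\<lambda>s. g 0 + integral {0..s} f)"
    using assms[OF True] by (intro continuous_intros indefinite_integral_continuous_1) (auto simp: integrable_on_def)
  then show ?thesis
    by (rule continuous_on_eq) (use integral_unique[OF assms] in auto)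
qed simp

lemma integral_increment:
  fixes f :: "real \<Rightarrow> 'a::banach"
  assumes "f integrable_on {0..t}" "0 \<le> s1" "s1 \<le> s2" "s2 \<le> t"
  shows "(f has_integral (integral {0..s2} f - integral {0..s1} f)) {s1..s2}"
proof -
  have 2: "f integrable_on {0..s2}" "f integrable_on {s1..s2}"
    using assms by (auto intro: integrable_subinterval_real)
  then have "integral {0..s1} f + integral {s1..s2} f = integral {0..s2} f"
    using assms by (intro Henstock_Kurzweil_Integration.integral_combine) auto
  then show ?thesis using 2 by (simp add: has_integral_iff algebra_simps)
qed

text \<open>A solution provides only gauge integrability of the leader velocity; a finite integral
  of its norm upgrades this to absolute integrability.\<close>

lemma integrable_on_norm_if_nn_integral_finite:
  fixes f :: "'a::euclidean_space \<Rightarrow> 'b::euclidean_space"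
  assumes "f integrable_on S" "S \<in> sets lebesgue"
    and "set_nn_integral lborel S (\<lambda>s. ennreal (norm (f s))) < \<infinity>"
  shows "(\<lambda>s. norm (f s)) integrable_on S"
proof -
  have "(\<integral>\<^sup>+ s. ennreal (norm (f s)) \<partial>lebesgue_on S) < \<infinity>"
    using assms(2,3) by (simp add: nn_integral_restrict_space nn_integral_completion)
  then have "integrable (lebesgue_on S) f"
    using integrable_iff_integrable_on[OF assms(2)] assms(1) by blast
  then have "f absolutely_integrable_on S"
    using absolutely_integrable_measurable[OF assms(2), of f] integrable_norm[of "lebesgue_on S" f]
    by (auto simp: o_def)
  then show ?thesis by (simp add: absolutely_integrable_on_def)
qed

section \<open>Distance to the leader hull\<close>

lemma leader_hull_compact: "compact (leader_hull y)"
  unfolding leader_hull_def by (intro compact_convex_hull finite_imp_compact) simp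

lemma leader_hull_nonempty: "leader_hull y \<noteq> {}"
  unfolding leader_hull_def by simp

lemma infdist_le_dist_L: "infdist (x $ i) (leader_hull y) \<le> dist_L x y"
  unfolding dist_L_def by (intro Max_ge) auto

lemma dist_L_nonneg: "0 \<le> dist_L x y"
  by (rule order_trans[OF infdist_nonneg infdist_le_dist_L[of _ undefined]])

text \<open>The half-space containing all leaders contains their hull, in particular the point
  closest to \<open>p\<close>; Cauchy-Schwarz bounds the remaining displacement.\<close>

lemma inner_le_infdist_leader_hull:
  assumes e: "norm e = 1" and le: "\<And>j. e \<bullet> (y $ j) \<le> c"
  shows "e \<bullet> p \<le> c + infdist p (leader_hull y)"
proof -
  obtain q where q: "q \<in> leader_hull y" "infdist p (leader_hull y) = dist p q"
    using infdist_attains_inf[of "leader_hull y" p] leader_hull_compact leader_hull_nonempty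
      compact_imp_closed by blast
  have "leader_hull y \<subseteq> {z. e \<bullet> z \<le> c}"
    unfolding leader_hull_def by (intro hull_minimal convex_halfspace_le) (use le in auto)
  then have "e \<bullet> q \<le> c" using q by auto
  moreover have "e \<bullet> (p - q) \<le> dist p q"
    using norm_cauchy_schwarz[of e "p - q"] e by (simp add: dist_norm)
  ultimately show ?thesis using q by (simp add: inner_diff_right)
qed

text \<open>Take \<open>e\<close> as the normalised difference between \<open>p\<close> and its
  projection \<open>q\<close>, and \<open>h = e \<bullet> q\<close>. The variational inequality of
  the projection makes this a supporting half-space.\<close>

lemma leader_hull_normal:
  assumes "0 < infdist p (leader_hull y)"
  obtains e h where "norm e = 1" "\<And>j. e \<bullet> (y $ j) \<le> h" "infdist p (leader_hull y) = e \<bullet> p - h"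
proof -
  obtain q where q: "q \<in> leader_hull y" "infdist p (leader_hull y) = dist p q"
    using infdist_attains_inf[of "leader_hull y" p] leader_hull_compact leader_hull_nonempty
      compact_imp_closed by blast
  define e where "e = (p - q) /\<^sub>R norm (p - q)"
  have n0: "norm (p - q) > 0" using q assms by (simp add: dist_norm)
  have "(p - q) \<bullet> (z - q) \<le> 0" if "z \<in> leader_hull y" for z
  proof (rule any_closest_point_dot[of "leader_hull y"])
    show "convex (leader_hull y)" "closed (leader_hull y)"
      using leader_hull_compact compact_imp_closed by (auto simp: leader_hull_def)
    show "\<forall>z\<in>leader_hull y. dist p q \<le> dist p z"
      using q infdist_le by metis
  qed (use q that in auto)
  then have "(p - q) \<bullet> (y $ j) \<le> (p - q) \<bullet> q" for j
    using hull_inc[of "y $ j" "range (($) y)" convex] by (force simp: leader_hull_def inner_diff_right)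
  then have "e \<bullet> (y $ j) \<le> e \<bullet> q" for j
    using n0 unfolding e_def by (simp add: mult_left_mono)
  moreover have "e \<bullet> p - e \<bullet> q = norm (p - q)"
    unfolding e_def inner_diff_right[symmetric]
    using n0 by (simp add: power2_norm_eq_inner[symmetric] power2_eq_square)
  moreover have "norm e = 1" using n0 by (simp add: e_def)
  ultimately show ?thesis using that[of e "e \<bullet> q"] q by (simp add: dist_norm)
qed

section \<open>Jointly connected networks are stable\<close>

text \<open>All terms are at most \<open>- (r * \<eta>)\<close>, so a single active arc already
  guarantees the definite rate, whatever the number of arcs.\<close>

lemma sum_le_minus:
  fixes c f :: "'e::finite \<Rightarrow> real"
  assumes "\<And>j. j \<in> A \<Longrightarrow> r \<le> c j" "0 < r" "0 \<le> \<eta>" "\<And>j. j \<in> A \<Longrightarrow> f j \<le> - \<eta>"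
  shows "(\<Sum>j\<in>A. c j * f j) \<le> (if A = {} then 0 else - (r * \<eta>))"
proof -
  have *: "c j * f j \<le> - (r * \<eta>)" if "j \<in> A" for j
  proof -
    have "r * \<eta> \<le> c j * (- f j)" using assms(1)[OF that] assms(2,3) assms(4)[OF that] by (intro mult_mono) auto
    then show ?thesis by simp
  qed
  show ?thesis
  proof (cases "A = {}")
    case False
    have "(\<Sum>j\<in>A. c j * f j) \<le> real (card A) * - (r * \<eta>)" using * by (rule sum_bounded_above)
    also have "\<dots> \<le> 1 * - (r * \<eta>)"
    proof (rule mult_right_mono_neg)
      show "1 \<le> real (card A)" using False by (simp add: Suc_leI card_gt_0_iff)
    qed (use assms(2,3) in auto)
    finally show ?thesis using False by simp
  qed simp
qed

text \<open>All that the upper bound needs from a solution: \<open>U\<close> and \<open>W\<close> majorise the accumulated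
  leader and follower inputs, and the last clause is a mean value inequality for the followers.\<close>

definition driven_trajectory ::
  "(real \<Rightarrow> ('n::finite + 'k::finite) rel) \<Rightarrow>
   ('n \<Rightarrow> 'n \<Rightarrow> real^'d^'n \<Rightarrow> real^'d^'k \<Rightarrow> real \<Rightarrow> real) \<Rightarrow>
   ('n \<Rightarrow> 'k \<Rightarrow> real^'d^'n \<Rightarrow> real^'d^'k \<Rightarrow> real \<Rightarrow> real) \<Rightarrow>
   (real \<Rightarrow> real^'d::finite^'n) \<Rightarrow> (real \<Rightarrow> real^'d^'k) \<Rightarrow>
   (real \<Rightarrow> real) \<Rightarrow> (real \<Rightarrow> real) \<Rightarrow> real \<Rightarrow> bool" where
  "driven_trajectory \<sigma> a b x y U W t \<longleftrightarrow>
     continuous_on {0..t} x \<and> continuous_on {0..t} W \<and> U 0 = 0 \<and> W 0 = 0 \<and>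
     (\<forall>s1 s2. 0 \<le> s1 \<longrightarrow> s1 \<le> s2 \<longrightarrow> s2 \<le> t \<longrightarrow> W s1 \<le> W s2 \<and>
       (\<forall>j. norm (y s2 $ j - y s1 $ j) \<le> U s2 - U s1) \<and>
       (\<forall>i e K. norm e = 1 \<longrightarrow>
         (\<forall>s\<in>{s1..s2}. e \<bullet> follower_rhs \<sigma> a b (\<lambda>_. 0) (x s) (y s) s $ i \<le> K) \<longrightarrow>
         e \<bullet> (x s2 $ i - x s1 $ i) \<le> K * (s2 - s1) + (W s2 - W s1)))"

lemma driven_trajectory_mono:
  assumes "driven_trajectory \<sigma> a b x y U W t" "s \<le> t"
  shows "driven_trajectory \<sigma> a b x y U W s"
proof -
  have "continuous_on {0..s} x" "continuous_on {0..s} W"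
    using assms by (auto simp: driven_trajectory_def elim: continuous_on_subset)
  then show ?thesis using assms unfolding driven_trajectory_def by auto
qed

locale switched_network =
  fixes \<sigma> :: "real \<Rightarrow> ('n::finite + 'k::finite) rel"
    and \<tau>D :: real
    and a :: "'n \<Rightarrow> 'n \<Rightarrow> real^'d::finite^'n \<Rightarrow> real^'d^'k \<Rightarrow> real \<Rightarrow> real"
    and b :: "'n \<Rightarrow> 'k \<Rightarrow> real^'d^'n \<Rightarrow> real^'d^'k \<Rightarrow> real \<Rightarrow> real"
    and a_lo b_lo :: real
  assumes dwell: "dwell_time_signal \<sigma> \<tau>D"
    and a_cont: "continuous_on UNIV (\<lambda>(x, y, t). a i j x y t)"
    and b_cont: "continuous_on UNIV (\<lambda>(x, y, t). b i l x y t)"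
    and a_lo: "0 < a_lo" "a_lo \<le> a i j x y t"
    and b_lo: "0 < b_lo" "b_lo \<le> b i l x y t"
    and acyc: "acyclic (follower_subgraph (joint_graph \<sigma> {0..}))"
begin

section \<open>Induction order on the followers and windows of activity\<close>

definition follower_arcs :: "'n rel" where
  "follower_arcs = {(j, i). (Inl j, Inl i) \<in> joint_graph \<sigma> {0..}}"

text \<open>Acyclicity of a finite relation gives well-founded induction from in-neighbours to their
  receivers.\<close>

lemma wf_follower_arcs: "wf follower_arcs"
proof -
  have "wf (follower_subgraph (joint_graph \<sigma> {0..}))"
    using acyc by (intro finite_acyclic_wf) auto
  moreover have "follower_arcs \<subseteq> inv_image (follower_subgraph (joint_graph \<sigma> {0..})) Inl"
    by (auto simp: follower_arcs_def follower_subgraph_def)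
  ultimately show ?thesis using wf_subset by blast
qed

lemma N_set_follower_arcs: "0 \<le> t \<Longrightarrow> j \<in> N_set (\<sigma> t) i \<Longrightarrow> (j, i) \<in> follower_arcs"
  by (auto simp: N_set_def follower_arcs_def joint_graph_def)

definition receives :: "'n \<Rightarrow> real \<Rightarrow> bool" where
  "receives i t \<longleftrightarrow> N_set (\<sigma> t) i \<noteq> {} \<or> L_set (\<sigma> t) i \<noteq> {}"

text \<open>The last arc of a leader path in the joint graph enters \<open>i\<close> at some time,
  and the dwell time widens that instant to a window.\<close>

lemma JLC_receives:
  assumes "JLC \<sigma>"
  shows "\<exists>p\<ge>T. \<forall>s. p \<le> s \<longrightarrow> s \<le> p + \<tau>D / 4 \<longrightarrow> receives i s"
proof -
  \<comment> \<open>The window may begin up to \<open>\<tau>D\<close> before the arc is seen; the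
    shift keeps it after \<open>T\<close>.\<close>
  define t0 where "t0 = max 0 T + \<tau>D"
  have "\<tau>D > 0" using dwell by (simp add: dwell_time_signal_def)
  then have "L_connected (joint_graph \<sigma> {t0..})"
    using assms by (simp add: JLC_def t0_def)
  then obtain l where "(Inr l, Inl i) \<in> (joint_graph \<sigma> {t0..})\<^sup>+"
    unfolding L_connected_def by blast
  then obtain z where "(z, Inl i) \<in> joint_graph \<sigma> {t0..}"
    by (meson tranclD2)
  then obtain t where t: "t0 \<le> t" "(z, Inl i) \<in> \<sigma> t"
    by (auto simp: joint_graph_def)
  have "receives i t"
    using t(2) by (cases z) (auto simp: receives_def N_set_def L_set_def)
  have "\<tau>D \<le> t" using t(1) \<open>\<tau>D > 0\<close> by (auto simp: t0_def)
  then obtain p where p: "t - \<tau>D \<le> p" "\<And>s. p \<le> s \<Longrightarrow> s \<le> p + \<tau>D / 4 \<Longrightarrow> \<sigma> s = \<sigma> t"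
    using dwell_time_persistence[OF dwell] by blast
  have "receives i s" if "p \<le> s" "s \<le> p + \<tau>D / 4" for s
    using p(2)[OF that] \<open>receives i t\<close> by (simp add: receives_def)
  moreover have "T \<le> p" using p(1) t(1) by (simp add: t0_def)
  ultimately show ?thesis by blast
qed

lemma inner_follower_rhs:
  "e \<bullet> follower_rhs \<sigma> a b w x y t $ i =
     (\<Sum>j\<in>N_set (\<sigma> t) i. a i j x y t * (e \<bullet> x $ j - e \<bullet> x $ i))
   + (\<Sum>l\<in>L_set (\<sigma> t) i. b i l x y t * (e \<bullet> y $ l - e \<bullet> x $ i)) + e \<bullet> w t $ i"
  by (simp add: follower_rhs_def inner_add_right inner_sum_right inner_diff_right)

definition rate :: real where "rate = min a_lo b_lo"

lemma rate_pos: "0 < rate" and rate_a: "rate \<le> a i j x y t" and rate_b: "rate \<le> b i l x y t"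
  using a_lo(1) a_lo(2)[of i j x y t] b_lo(1) b_lo(2)[of i l x y t] by (auto simp: rate_def)

text \<open>Height of follower \<open>i\<close> at time \<open>s\<close> above the level \<open>h\<close> of the leader hull at the final
  time \<open>t\<close>, in direction \<open>e\<close>. Subtracting the whole of \<open>U t\<close> pays in advance for all later leader
  motion, so that \<open>gap\<close> obeys an unforced differential inequality.\<close>

definition gap :: "real^'d \<Rightarrow> real \<Rightarrow> (real \<Rightarrow> real^'d^'n) \<Rightarrow> (real \<Rightarrow> real) \<Rightarrow> (real \<Rightarrow> real) \<Rightarrow> real \<Rightarrow> 'n
    \<Rightarrow> real \<Rightarrow> real" where
  "gap e h x U W t i s = e \<bullet> x s $ i - h - U t - W s"

section \<open>Gap estimates along one trajectory in a fixed direction\<close>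

context
  fixes x :: "real \<Rightarrow> real^'d^'n" and y :: "real \<Rightarrow> real^'d^'k" and U W :: "real \<Rightarrow> real"
    and t :: real and e :: "real^'d" and h :: real
  assumes drv: "driven_trajectory \<sigma> a b x y U W t"
    and e: "norm e = 1" and h: "\<And>l. e \<bullet> y t $ l \<le> h"
begin

lemma U_W_nonneg:
  assumes "0 \<le> s" "s \<le> t"
  shows "0 \<le> U s" "0 \<le> W s"
proof -
  have "norm (y s $ undefined - y 0 $ undefined) \<le> U s - U 0" "W 0 \<le> W s" "W 0 = 0" "U 0 = 0"
    using drv assms unfolding driven_trajectory_def by blast+
  then show "0 \<le> U s" "0 \<le> W s"
    using norm_ge_zero[of "y s $ undefined - y 0 $ undefined"] by linarith+
qed

text \<open>From \<open>s\<close> to \<open>t\<close> each leader moves by at most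
  \<open>U t - U s\<close>, so traced back from time \<open>t\<close> it exceeds \<open>h\<close> by
  no more than that.\<close>

lemma leader_height:
  assumes "0 \<le> s" "s \<le> t"
  shows "e \<bullet> y s $ l \<le> h + U t - U s"
proof -
  have "norm (y t $ l - y s $ l) \<le> U t - U s"
    using drv assms unfolding driven_trajectory_def by blast
  moreover have "e \<bullet> (y s $ l - y t $ l) \<le> norm (y t $ l - y s $ l)"
    using norm_cauchy_schwarz[of e "y s $ l - y t $ l"] e by (simp add: norm_minus_commute)
  ultimately show ?thesis using h[of l] by (simp add: inner_diff_right)
qed

lemma follower_height:
  assumes "0 \<le> s" "s \<le> t"
  shows "e \<bullet> x s $ j \<le> h + U t - U s + infdist (x s $ j) (leader_hull (y s))"
  using inner_le_infdist_leader_hull[OF e leader_height[OF assms]] .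

text \<open>An in-neighbour has height at most \<open>h + U t + R + W s\<close>, because the
  \<open>U s\<close> in its distance bound cancels the one in \<open>follower_height\<close>.
  Leaders are no higher, and \<open>i\<close> exceeds this level by at least \<open>\<eta>\<close>.
  Hence every incoming arc pulls \<open>i\<close> down.\<close>

lemma gap_rate:
  assumes s: "0 \<le> s" "s \<le> t" and "0 \<le> R" "0 \<le> \<eta>"
    and pred: "\<And>j. (j, i) \<in> follower_arcs \<Longrightarrow> infdist (x s $ j) (leader_hull (y s)) \<le> R + U s + W s"
    and gap: "R + \<eta> \<le> gap e h x U W t i s"
  shows "e \<bullet> follower_rhs \<sigma> a b (\<lambda>_. 0) (x s) (y s) s $ i \<le> (if receives i s then - (rate * \<eta>) else 0)"
proof -
  have xi: "h + U t + W s + R + \<eta> \<le> e \<bullet> x s $ i" using gap by (simp add: gap_def)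
  have "e \<bullet> x s $ j - e \<bullet> x s $ i \<le> - \<eta>" if "j \<in> N_set (\<sigma> s) i" for j
    using follower_height[OF s, of j] pred[OF N_set_follower_arcs[OF s(1) that]] xi by linarith
  then have 1: "(\<Sum>j\<in>N_set (\<sigma> s) i. a i j (x s) (y s) s * (e \<bullet> x s $ j - e \<bullet> x s $ i))
      \<le> (if N_set (\<sigma> s) i = {} then 0 else - (rate * \<eta>))"
    using assms(4) rate_pos rate_a by (intro sum_le_minus) auto
  have "e \<bullet> y s $ l - e \<bullet> x s $ i \<le> - \<eta>" for l
    using leader_height[OF s, of l] xi U_W_nonneg[OF s] \<open>0 \<le> R\<close> by linarith
  then have 2: "(\<Sum>l\<in>L_set (\<sigma> s) i. b i l (x s) (y s) s * (e \<bullet> y s $ l - e \<bullet> x s $ i))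
      \<le> (if L_set (\<sigma> s) i = {} then 0 else - (rate * \<eta>))"
    using assms(4) rate_pos rate_b by (intro sum_le_minus) auto
  have "0 \<le> rate * \<eta>" using rate_pos assms(4) by simp
  then show ?thesis
    using 1 2 unfolding inner_follower_rhs receives_def by (auto split: if_splits)
qed

text \<open>The term \<open>W\<close> subtracted in \<open>gap\<close> absorbs exactly the follower
  input of the mean value clause.\<close>

lemma gap_increment:
  assumes "0 \<le> s1" "s1 \<le> s2" "s2 \<le> t"
    and "\<And>s. s1 \<le> s \<Longrightarrow> s \<le> s2 \<Longrightarrow> e \<bullet> follower_rhs \<sigma> a b (\<lambda>_. 0) (x s) (y s) s $ i \<le> K"
  shows "gap e h x U W t i s2 \<le> gap e h x U W t i s1 + K * (s2 - s1)"
proof -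
  have "e \<bullet> (x s2 $ i - x s1 $ i) \<le> K * (s2 - s1) + (W s2 - W s1)"
    using drv assms e unfolding driven_trajectory_def by auto
  then show ?thesis by (simp add: gap_def inner_diff_right)
qed

text \<open>Barrier argument: wherever the gap is at least \<open>c \<ge> R\<close>,
  \<open>gap_rate\<close> with \<open>\<eta> = 0\<close> shows that it cannot increase.\<close>

lemma gap_le:
  assumes s: "0 \<le> s1" "s1 \<le> s2" "s2 \<le> t" and "0 \<le> R"
    and pred: "\<And>j s. (j, i) \<in> follower_arcs \<Longrightarrow> s1 \<le> s \<Longrightarrow> s \<le> s2 \<Longrightarrow>
      infdist (x s $ j) (leader_hull (y s)) \<le> R + U s + W s"
    and "R \<le> c" "gap e h x U W t i s1 \<le> c"
  shows "gap e h x U W t i s2 \<le> c"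
proof (rule barrier[of s1 s2])
  have "continuous_on {0..t} x" "continuous_on {0..t} W"
    using drv by (auto simp: driven_trajectory_def)
  then have "continuous_on {s1..s2} x" "continuous_on {s1..s2} W"
    using s by (auto elim: continuous_on_subset)
  then show "continuous_on {s1..s2} (gap e h x U W t i)"
    unfolding gap_def by (intro continuous_intros)
  fix s assume s': "s1 \<le> s" "s \<le> s2" and ge: "\<And>r. s \<le> r \<Longrightarrow> r \<le> s2 \<Longrightarrow> c \<le> gap e h x U W t i r"
  have "e \<bullet> follower_rhs \<sigma> a b (\<lambda>_. 0) (x r) (y r) r $ i \<le> 0" if r: "s \<le> r" "r \<le> s2" for r
    using gap_rate[of r R 0 i] pred[of _ r] ge[OF r] r s s' assms(4,6) by (auto split: if_splits)
  then show "gap e h x U W t i s2 \<le> gap e h x U W t i s"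
    using gap_increment[of s s2 i 0] s s' by auto
qed (use assms in auto)

text \<open>Either the gap touches \<open>R + \<eta>\<close> during the window and remains below it
  by \<open>gap_le\<close>, or it exceeds this level throughout and falls at the full rate
  \<open>rate * \<eta>\<close>.\<close>

lemma gap_contract:
  assumes p: "0 \<le> p" "0 \<le> \<delta>" "p + \<delta> \<le> t" and nonneg: "0 \<le> R" "0 \<le> \<eta>"
    and pred: "\<And>j s. (j, i) \<in> follower_arcs \<Longrightarrow> p \<le> s \<Longrightarrow> s \<le> p + \<delta> \<Longrightarrow>
      infdist (x s $ j) (leader_hull (y s)) \<le> R + U s + W s"
    and rec: "\<And>s. p \<le> s \<Longrightarrow> s \<le> p + \<delta> \<Longrightarrow> receives i s"
  shows "gap e h x U W t i (p + \<delta>) \<le> max (R + \<eta>) (gap e h x U W t i p - rate * \<eta> * \<delta>)"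
proof (cases "\<exists>s\<ge>p. s \<le> p + \<delta> \<and> gap e h x U W t i s \<le> R + \<eta>")
  case True
  then obtain s where "p \<le> s" "s \<le> p + \<delta>" "gap e h x U W t i s \<le> R + \<eta>" by blast
  then have "gap e h x U W t i (p + \<delta>) \<le> R + \<eta>"
    using gap_le[of s "p + \<delta>" R i "R + \<eta>"] pred p nonneg by auto
  then show ?thesis by simp
next
  case False
  have "e \<bullet> follower_rhs \<sigma> a b (\<lambda>_. 0) (x s) (y s) s $ i \<le> - (rate * \<eta>)"
    if "p \<le> s" "s \<le> p + \<delta>" for s
    using gap_rate[of s R \<eta> i] pred[of _ s] False rec[OF that] p that nonneg by auto
  then show ?thesis
    using gap_increment[of p "p + \<delta>" i "- (rate * \<eta>)"] p by auto
qed

end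

text \<open>Both claims are carried through the induction: the first controls a follower from time
  0, before its in-neighbours have settled, and the second starts from their settled bounds. The
  settling time \<open>T\<close> depends only on \<open>i\<close> and \<open>\<epsilon>\<close>,
  never on the trajectory.\<close>

lemma follower_bounds:
  assumes "JLC \<sigma>"
  shows "(\<forall>x y U W t. 0 \<le> t \<longrightarrow> driven_trajectory \<sigma> a b x y U W t \<longrightarrow>
            infdist (x t $ i) (leader_hull (y t)) \<le> dist_L (x 0) (y 0) + U t + W t) \<and>
         (\<forall>\<epsilon>>0. \<exists>T\<ge>0. \<forall>x y U W t. T \<le> t \<longrightarrow> driven_trajectory \<sigma> a b x y U W t \<longrightarrow>
            infdist (x t $ i) (leader_hull (y t)) \<le> \<epsilon> * dist_L (x 0) (y 0) + U t + W t)"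
proof (induction i rule: wf_induct_rule[OF wf_follower_arcs])
  case (1 i)
  have IH1: "infdist (x s $ j) (leader_hull (y s)) \<le> dist_L (x 0) (y 0) + U s + W s"
    if "(j, i) \<in> follower_arcs" "driven_trajectory \<sigma> a b x y U W t" "0 \<le> s" "s \<le> t" for j x y U W s t
    using 1[OF that(1)] driven_trajectory_mono[OF that(2,4)] that(3) by blast
  have start: "gap e h x U W t i 0 \<le> dist_L (x 0) (y 0)"
    if "driven_trajectory \<sigma> a b x y U W t" "norm e = 1" "\<And>l. e \<bullet> y t $ l \<le> h" "0 \<le> t" for e h x y U W t
  proof -
    have "U 0 = 0" "W 0 = 0" using that(1) by (auto simp: driven_trajectory_def)
    then show ?thesis
      using follower_height[OF that(1-3), of 0 i] infdist_le_dist_L[of "x 0" i "y 0"] that(4)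
      by (simp add: gap_def)
  qed
  have gap_start: "gap e h x U W t i s \<le> dist_L (x 0) (y 0)"
    if "driven_trajectory \<sigma> a b x y U W t" "norm e = 1" "\<And>l. e \<bullet> y t $ l \<le> h" "0 \<le> s" "s \<le> t" for e h x y U W s t
    using that start[OF that(1-3)] IH1[OF _ that(1)] dist_L_nonneg[of "x 0" "y 0"]
    by (intro gap_le[OF that(1-3), of 0 s "dist_L (x 0) (y 0)"]) auto
  \<comment> \<open>Outside the hull, the outward normal turns the distance into a gap plus
    \<open>U t + W t\<close>, so a gap bound for all directions suffices.\<close>
  have reduce: "infdist (x t $ i) (leader_hull (y t)) \<le> c + U t + W t"
    if drv: "driven_trajectory \<sigma> a b x y U W t" and t: "0 \<le> t" and "0 \<le> c"
      and gap: "\<And>e h. norm e = 1 \<Longrightarrow> (\<And>l. e \<bullet> y t $ l \<le> h) \<Longrightarrow> gap e h x U W t i t \<le> c" for x y U W t c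
  proof (cases "0 < infdist (x t $ i) (leader_hull (y t))")
    case True
    then obtain e h where eh: "norm e = 1" "\<And>l. e \<bullet> y t $ l \<le> h"
      "infdist (x t $ i) (leader_hull (y t)) = e \<bullet> x t $ i - h"
      using leader_hull_normal by blast
    then show ?thesis using gap[OF eh(1,2)] by (simp add: gap_def)
  next
    case False
    \<comment> \<open>For a follower in the hull only the signs of \<open>U\<close> and
      \<open>W\<close> matter; any unit vector serves to invoke \<open>U_W_nonneg\<close>.\<close>
    have e: "norm (axis undefined 1 :: real^'d) = 1" (is "norm ?e = 1") by simp
    have "?e \<bullet> y t $ l \<le> Max (range (\<lambda>l. ?e \<bullet> y t $ l))" for l by (intro Max_ge) auto
    then have "0 \<le> U t" "0 \<le> W t" using U_W_nonneg[OF drv e _ t order_refl] by blast+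
    then show ?thesis using False \<open>0 \<le> c\<close> by linarith
  qed
  have first: "infdist (x t $ i) (leader_hull (y t)) \<le> dist_L (x 0) (y 0) + U t + W t"
    if "0 \<le> t" "driven_trajectory \<sigma> a b x y U W t" for x y U W t
    using that dist_L_nonneg gap_start[OF that(2)] by (intro reduce) auto
  have "\<exists>T\<ge>0. \<forall>x y U W t. T \<le> t \<longrightarrow> driven_trajectory \<sigma> a b x y U W t \<longrightarrow>
            infdist (x t $ i) (leader_hull (y t)) \<le> \<epsilon> * dist_L (x 0) (y 0) + U t + W t"
    if "0 < \<epsilon>" for \<epsilon>
  proof -
    \<comment> \<open>Half of \<open>\<epsilon>\<close> is spent on the in-neighbours, the other
      half on the margin \<open>\<eta>\<close> in the contraction. The maximum of the finitely many
      settling times then serves all of them.\<close>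
    have "\<forall>j. \<exists>T. (j, i) \<in> follower_arcs \<longrightarrow> (0 \<le> T \<and> (\<forall>x y U W t. T \<le> t \<longrightarrow> driven_trajectory \<sigma> a b x y U W t \<longrightarrow>
            infdist (x t $ j) (leader_hull (y t)) \<le> \<epsilon> / 2 * dist_L (x 0) (y 0) + U t + W t))"
      using 1 \<open>0 < \<epsilon>\<close> half_gt_zero by meson
    then obtain Tj where Tj: "\<And>j x y U W t. (j, i) \<in> follower_arcs \<Longrightarrow> Tj j \<le> t \<Longrightarrow>
        driven_trajectory \<sigma> a b x y U W t \<Longrightarrow>
        infdist (x t $ j) (leader_hull (y t)) \<le> \<epsilon> / 2 * dist_L (x 0) (y 0) + U t + W t"
      by metis
    define T where "T = Max (insert 0 (range Tj))"
    have T: "0 \<le> T" "Tj j \<le> T" for j unfolding T_def by (rule Max_ge; simp)+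
    have \<tau>: "0 < \<tau>D" using dwell by (simp add: dwell_time_signal_def)
    \<comment> \<open>\<open>N\<close> windows remove a total of at least \<open>r0\<close>, the
      initial distance. As the drop per window is proportional to \<open>r0\<close>,
      \<open>N\<close> is independent of the trajectory.\<close>
    obtain N where N: "1 \<le> real N * (rate * (\<epsilon> / 2) * (\<tau>D / 4))"
    proof -
      have "0 < rate * (\<epsilon> / 2) * (\<tau>D / 4)" using rate_pos \<tau> \<open>0 < \<epsilon>\<close> by simp
      then show ?thesis using ex_less_of_nat_mult[of "rate * (\<epsilon> / 2) * (\<tau>D / 4)" 1] that less_imp_le by blast
    qed
    have "\<exists>T'\<ge>T. \<forall>G t lev \<kappa>. T' \<le> t \<longrightarrow> 0 \<le> \<kappa> \<longrightarrow>
     (\<forall>s1 s2 c. T \<le> s1 \<longrightarrow> s1 \<le> s2 \<longrightarrow> s2 \<le> t \<longrightarrow> lev \<le> c \<longrightarrow> G s1 \<le> c \<longrightarrow> G s2 \<le> c) \<longrightarrow>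
     (\<forall>p\<ge>T. (\<forall>s. p \<le> s \<longrightarrow> s \<le> p + \<tau>D / 4 \<longrightarrow> receives i s) \<longrightarrow> p + \<tau>D / 4 \<le> t \<longrightarrow>
        G (p + \<tau>D / 4) \<le> max lev (G p - \<kappa>)) \<longrightarrow>
     G T' \<le> max lev (G T - real N * \<kappa>)"
      by (rule iterated_contraction) (use JLC_receives[OF assms] \<tau> in auto)
    then obtain T' where T': "T \<le> T'" and step: "\<forall>G t lev \<kappa>. T' \<le> t \<longrightarrow> 0 \<le> \<kappa> \<longrightarrow>
     (\<forall>s1 s2 c. T \<le> s1 \<longrightarrow> s1 \<le> s2 \<longrightarrow> s2 \<le> t \<longrightarrow> lev \<le> c \<longrightarrow> G s1 \<le> c \<longrightarrow> G s2 \<le> c) \<longrightarrow>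
     (\<forall>p\<ge>T. (\<forall>s. p \<le> s \<longrightarrow> s \<le> p + \<tau>D / 4 \<longrightarrow> receives i s) \<longrightarrow> p + \<tau>D / 4 \<le> t \<longrightarrow>
        G (p + \<tau>D / 4) \<le> max lev (G p - \<kappa>)) \<longrightarrow>
     G T' \<le> max lev (G T - real N * \<kappa>)"
      by (elim exE conjE) (rule that)
    show ?thesis
    proof (intro exI[of _ T'] conjI allI impI)
      show "0 \<le> T'" using T T' by linarith
      fix x y U W t
      assume t: "T' \<le> t" and drv: "driven_trajectory \<sigma> a b x y U W t"
      define r0 where "r0 = dist_L (x 0) (y 0)"
      have r0: "0 \<le> r0" by (simp add: r0_def dist_L_nonneg)
      define R where "R = \<epsilon> / 2 * r0"
      have R: "0 \<le> R" using r0 \<open>0 < \<epsilon>\<close> by (simp add: R_def)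
      have pred: "infdist (x s $ j) (leader_hull (y s)) \<le> R + U s + W s"
        if "(j, i) \<in> follower_arcs" "T \<le> s" "s \<le> t" for j s
        using Tj[OF that(1) _ driven_trajectory_mono[OF drv that(3)]] T(2)[of j] that(2)
        by (simp add: R_def r0_def)
      show "infdist (x t $ i) (leader_hull (y t)) \<le> \<epsilon> * dist_L (x 0) (y 0) + U t + W t"
        unfolding r0_def[symmetric]
      proof (rule reduce[OF drv])
        fix e h assume eh: "norm e = (1::real)" "\<And>l. e \<bullet> y t $ l \<le> h"
        let ?G = "gap e h x U W t i"
        have inv: "?G s2 \<le> c" if "T \<le> s1" "s1 \<le> s2" "s2 \<le> t" "R \<le> c" "?G s1 \<le> c" for s1 s2 c
          by (rule gap_le[OF drv eh, of s1 s2 R]) (use pred that T R in auto)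
        \<comment> \<open>The margin is \<open>\<eta> = R\<close>, so the floor \<open>R + R\<close>
          is exactly \<open>\<epsilon> * r0\<close>.\<close>
        have "?G T' \<le> max (R + R) (?G T - real N * (rate * R * (\<tau>D / 4)))"
        proof (rule step[rule_format, OF t])
          show "0 \<le> rate * R * (\<tau>D / 4)" using rate_pos R \<tau> by simp
          show "?G s2 \<le> c" if "T \<le> s1" "s1 \<le> s2" "s2 \<le> t" "R + R \<le> c" "?G s1 \<le> c" for s1 s2 c
            using inv[OF that(1-3) _ that(5)] that(4) R by simp
          show "?G (p + \<tau>D / 4) \<le> max (R + R) (?G p - rate * R * (\<tau>D / 4))"
            if "T \<le> p" "\<And>s. p \<le> s \<Longrightarrow> s \<le> p + \<tau>D / 4 \<Longrightarrow> receives i s" "p + \<tau>D / 4 \<le> t" for p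
            by (rule gap_contract[OF drv eh]) (use pred that T R \<tau> in auto)
        qed
        moreover have "?G T - real N * (rate * R * (\<tau>D / 4)) \<le> 0"
        proof -
          have "?G T \<le> r0" unfolding r0_def by (rule gap_start[OF drv eh]) (use T T' t in auto)
          moreover have "1 * r0 \<le> real N * (rate * (\<epsilon> / 2) * (\<tau>D / 4)) * r0"
            using N r0 by (rule mult_right_mono)
          ultimately show ?thesis by (simp add: R_def mult_ac)
        qed
        ultimately have "?G T' \<le> R + R" using R by auto
        then have "?G t \<le> R + R" using inv[of T' t] T' t R by auto
        then show "?G t \<le> \<epsilon> * r0" by (simp add: R_def)
      qed (use T T' t r0 \<open>0 < \<epsilon>\<close> in auto)
    qed
  qed
  then show ?case using first by blast
qed

end

section \<open>From solutions of system (5) to the stability estimate\<close>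

lemma follower_rhs_split: "follower_rhs \<sigma> a b w x y t $ i = follower_rhs \<sigma> a b (\<lambda>_. 0) x y t $ i + w t $ i"
  by (simp add: follower_rhs_def)

text \<open>The mean value clause comes from integrating the pointwise bound
  \<open>K + norm (w s)\<close>, obtained by Cauchy-Schwarz for the unit vector
  \<open>e\<close>.\<close>

lemma sys5_solution_driven:
  assumes sol: "sys5_solution \<sigma> a b u w x y" and w: "continuous_on {0..} w"
    and u: "(\<lambda>s. norm (u (y s) s)) integrable_on {0..t}"
  shows "driven_trajectory \<sigma> a b x y (\<lambda>s. integral {0..s} (\<lambda>r. norm (u (y r) r)))
           (\<lambda>s. integral {0..s} (\<lambda>r. norm (w r))) t"
proof -
  let ?U = "\<lambda>s. integral {0..s} (\<lambda>r. norm (u (y r) r))"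
  let ?W = "\<lambda>s. integral {0..s} (\<lambda>r. norm (w r))"
  have nw: "(\<lambda>r. norm (w r)) integrable_on {0..t}"
    by (intro integrable_continuous_real continuous_intros continuous_on_subset[OF w]) auto
  have yi: "((\<lambda>s. u (y s) s) has_integral (y s2 - y s1)) {s1..s2}" if "0 \<le> s1" "s1 \<le> s2" for s1 s2
    by (rule has_integral_increment) (use sol that in \<open>auto simp: sys5_solution_def\<close>)
  have xi: "((\<lambda>s. follower_rhs \<sigma> a b w (x s) (y s) s) has_integral (x s2 - x s1)) {s1..s2}"
    if "0 \<le> s1" "s1 \<le> s2" for s1 s2
    by (rule has_integral_increment) (use sol that in \<open>auto simp: sys5_solution_def\<close>)
  have "?W s1 \<le> ?W s2" if "0 \<le> s1" "s1 \<le> s2" "s2 \<le> t" for s1 s2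
    using has_integral_nonneg[OF integral_increment[OF nw that]] by simp
  moreover have "norm (y s2 $ j - y s1 $ j) \<le> ?U s2 - ?U s1" if s: "0 \<le> s1" "s1 \<le> s2" "s2 \<le> t" for s1 s2 j
  proof -
    have "norm ((y s2 - y s1) $ j) \<le> norm (y s2 - y s1)" by (rule Finite_Cartesian_Product.norm_nth_le)
    also have "\<dots> = norm (integral {s1..s2} (\<lambda>s. u (y s) s))"
      using integral_unique[OF yi[OF s(1,2)]] by simp
    also have "\<dots> \<le> integral {s1..s2} (\<lambda>s. norm (u (y s) s))"
      using yi[OF s(1,2)] integral_increment[OF u s]
      by (intro Henstock_Kurzweil_Integration.integral_norm_bound_integral) (auto simp: integrable_on_def)
    also have "\<dots> = ?U s2 - ?U s1" by (rule integral_unique[OF integral_increment[OF u s]])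
    finally show ?thesis by simp
  qed
  moreover have "e \<bullet> (x s2 $ i - x s1 $ i) \<le> K * (s2 - s1) + (?W s2 - ?W s1)"
    if s: "0 \<le> s1" "s1 \<le> s2" "s2 \<le> t" and e: "norm e = 1"
      and K: "\<forall>s\<in>{s1..s2}. e \<bullet> follower_rhs \<sigma> a b (\<lambda>_. 0) (x s) (y s) s $ i \<le> K" for s1 s2 i e K
  proof -
    have bl: "bounded_linear (\<lambda>v::real^'c^'a. e \<bullet> v $ i)"
      by (rule bounded_linear_compose[OF bounded_linear_inner_right bounded_linear_vec_nth])
    have 1: "((\<lambda>s. e \<bullet> follower_rhs \<sigma> a b w (x s) (y s) s $ i) has_integral (e \<bullet> (x s2 - x s1) $ i)) {s1..s2}"
      using has_integral_linear[OF xi[OF s(1,2)] bl] by (simp add: o_def)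
    have 2: "((\<lambda>s. K + norm (w s)) has_integral (K * (s2 - s1) + (?W s2 - ?W s1))) {s1..s2}"
      using has_integral_add[OF has_integral_const_real[of K s1 s2] integral_increment[OF nw s]] s
      by (simp add: mult.commute)
    have "e \<bullet> (x s2 - x s1) $ i \<le> K * (s2 - s1) + (?W s2 - ?W s1)"
    proof (rule has_integral_le[OF 1 2])
      fix s assume "s \<in> {s1..s2}"
      moreover have "e \<bullet> w s $ i \<le> norm (w s)"
        using norm_cauchy_schwarz[of e "w s $ i"] Finite_Cartesian_Product.norm_nth_le[of "w s" i]
        unfolding e by linarith
      ultimately show "e \<bullet> follower_rhs \<sigma> a b w (x s) (y s) s $ i \<le> K + norm (w s)"
        using K unfolding follower_rhs_split[of _ _ _ w] by (auto simp: inner_add_right intro: add_mono)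
    qed
    then show ?thesis by simp
  qed
  moreover have "continuous_on {0..t} ?W" by (rule indefinite_integral_continuous_1[OF nw])
  moreover have "continuous_on {0..t} x"
    by (rule has_integral_imp_continuous_on) (use sol in \<open>auto simp: sys5_solution_def\<close>)
  ultimately show ?thesis
    unfolding driven_trajectory_def by simp
qed

text \<open>\<open>Q\<close> quantifies over all trajectories and followers, so one rate
  \<open>B\<close> serves them all. The bounds are proportional to the initial distance, which
  permits the product form of \<open>\<beta>\<close>.\<close>

lemma (in switched_network) JLC_imp_SiISS:
  assumes "JLC \<sigma>"
  shows "SiISS \<sigma> a b"
proof -
  define Q where "Q \<epsilon> t \<longleftrightarrow> (\<forall>x y U W i. driven_trajectory \<sigma> a b x y U W t \<longrightarrow>
      infdist (x t $ i) (leader_hull (y t)) \<le> \<epsilon> * dist_L (x 0) (y 0) + U t + W t)" for \<epsilon> t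
  have "Q 1 t" if "0 \<le> t" for t
    using that follower_bounds[OF assms] unfolding Q_def by simp
  moreover have "\<exists>T. \<forall>t\<ge>T. Q \<epsilon> t" if "0 < \<epsilon>" for \<epsilon>
  proof -
    have "\<exists>T. \<forall>x y U W t. T \<le> t \<longrightarrow> driven_trajectory \<sigma> a b x y U W t \<longrightarrow>
            infdist (x t $ i) (leader_hull (y t)) \<le> \<epsilon> * dist_L (x 0) (y 0) + U t + W t" for i
      using conjunct2[OF follower_bounds[OF assms, of i], THEN spec[of _ \<epsilon>]] that by (elim impE exE) (assumption, blast)
    then obtain T where T: "\<forall>i x y U W t. T i \<le> t \<longrightarrow> driven_trajectory \<sigma> a b x y U W t \<longrightarrow>
            infdist (x t $ i) (leader_hull (y t)) \<le> \<epsilon> * dist_L (x 0) (y 0) + U t + W t"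
      by (rule choice[OF allI, THEN exE])
    have "Q \<epsilon> t" if t: "Max (range T) \<le> t" for t
    proof -
      have "T i \<le> t" for i by (rule order_trans[OF Max_ge t]) auto
      then show ?thesis using T by (simp add: Q_def)
    qed
    then show ?thesis by blast
  qed
  moreover have "Q \<epsilon>' t" if "Q \<epsilon> t" "\<epsilon> \<le> \<epsilon>'" for \<epsilon> \<epsilon>' t
    unfolding Q_def
  proof (intro allI impI)
    fix x y U W i assume "driven_trajectory \<sigma> a b x y U W t"
    then have "infdist (x t $ i) (leader_hull (y t)) \<le> \<epsilon> * dist_L (x 0) (y 0) + U t + W t"
      using that(1) by (simp add: Q_def)
    moreover have "\<epsilon> * dist_L (x 0) (y 0) \<le> \<epsilon>' * dist_L (x 0) (y 0)"
      using that(2) dist_L_nonneg by (rule mult_right_mono)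
    ultimately show "infdist (x t $ i) (leader_hull (y t)) \<le> \<epsilon>' * dist_L (x 0) (y 0) + U t + W t" by linarith
  qed
  ultimately obtain B where B: "continuous_on UNIV B" "antimono B" "(B \<longlongrightarrow> 0) at_top"
    "\<forall>t. 0 < B t" "\<forall>t\<ge>0. Q (B t) t"
    by (rule decay_rate_envelope[of Q]) blast
  define \<beta> where "\<beta> r t = r * B t" for r t
  \<comment> \<open>The factor 2 covers the sum of the two input norms, each of which is at most the
    norm of the pair.\<close>
  define \<gamma> where "\<gamma> s = 2 * s" for s :: real
  have "class_K \<gamma>"
    by (auto simp: class_K_def \<gamma>_def strict_mono_on_def intro!: continuous_intros)
  moreover have "class_KL \<beta>"
    unfolding class_KL_def
  proof (intro conjI allI impI)
    have "continuous_on ({0..} \<times> {0..}) (\<lambda>p. fst p * B (snd p))"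
      by (intro continuous_intros continuous_on_compose2[OF B(1)]) auto
    then show "continuous_on ({0..} \<times> {0..}) (\<lambda>(r, t). \<beta> r t)"
      by (simp add: \<beta>_def case_prod_beta)
    show "class_K (\<lambda>r. \<beta> r t)" for t
      using B(4)[THEN spec, of t] by (auto simp: class_K_def \<beta>_def strict_mono_on_def intro!: continuous_intros)
    show "\<beta> r t \<le> \<beta> r s" if "0 \<le> r" "s \<le> t" for r s t
      unfolding \<beta>_def using antimonoD[OF B(2) that(2)] that(1) by (rule mult_left_mono)
    show "((\<lambda>t. \<beta> r t) \<longlongrightarrow> 0) at_top" for r
      unfolding \<beta>_def by (rule tendsto_mult_right_zero[OF B(3)])
  qed
  moreover have "ennreal (dist_L (x t) (y t)) \<le> ennreal (\<beta> (dist_L (x 0) (y 0)) t)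
      + set_nn_integral lborel {0..t} (\<lambda>s. ennreal (\<gamma> (norm (u (y s) s, w s))))"
    if adm: "admissible_inputs u w" and sol: "sys5_solution \<sigma> a b u w x y" and t: "0 \<le> t" for u w x y t
  \<comment> \<open>An infinite input integral makes the estimate trivial; a finite one makes the
    leader speed integrable.\<close>
  proof (cases "set_nn_integral lborel {0..t} (\<lambda>s. ennreal (\<gamma> (norm (u (y s) s, w s)))) < \<infinity>")
    case True
    let ?u = "\<lambda>s. norm (u (y s) s)" and ?w = "\<lambda>s. norm (w s)"
    have w: "continuous_on {0..} w" using adm by (simp add: admissible_inputs_def)
    have le: "?u s \<le> norm (u (y s) s, w s)" "?w s \<le> norm (u (y s) s, w s)" for s
      by (rule norm_fst_le norm_snd_le)+
    have sum_le: "?u s + ?w s \<le> \<gamma> (norm (u (y s) s, w s))" for s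
      using add_mono[OF le(1)[of s] le(2)[of s]] by (simp only: \<gamma>_def mult_2)
    have u_le: "?u s \<le> \<gamma> (norm (u (y s) s, w s))" for s
      by (rule order_trans[OF _ sum_le[of s]]) simp
    have "set_nn_integral lborel {0..t} (\<lambda>s. ennreal (?u s))
        \<le> set_nn_integral lborel {0..t} (\<lambda>s. ennreal (\<gamma> (norm (u (y s) s, w s))))"
      by (intro nn_integral_mono mult_right_mono ennreal_leI u_le) simp
    then have fin: "set_nn_integral lborel {0..t} (\<lambda>s. ennreal (?u s)) < \<infinity>"
      using True by (rule le_less_trans)
    have "(\<lambda>s. u (y s) s) integrable_on {0..t}"
      using sol t by (auto simp: sys5_solution_def integrable_on_def)
    moreover have "{0..t} \<in> sets lebesgue" by (simp add: lmeasurable_iff_integrable)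
    ultimately have u: "?u integrable_on {0..t}"
      using fin by (rule integrable_on_norm_if_nn_integral_finite)
    have w': "?w integrable_on {0..t}"
      by (intro integrable_continuous_real continuous_intros continuous_on_subset[OF w]) auto
    let ?I = "integral {0..t} ?u + integral {0..t} ?w"
    have "infdist (x t $ i) (leader_hull (y t)) \<le> \<beta> (dist_L (x 0) (y 0)) t + ?I" for i
      using B(5)[rule_format, OF t, unfolded Q_def, rule_format, OF sys5_solution_driven[OF sol w u], of i]
      by (simp add: \<beta>_def mult.commute add.assoc)
    then have "dist_L (x t) (y t) \<le> \<beta> (dist_L (x 0) (y 0)) t + ?I"
      unfolding dist_L_def[of "x t"] by auto
    then have "ennreal (dist_L (x t) (y t)) \<le> ennreal (\<beta> (dist_L (x 0) (y 0)) t + ?I)"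
      by (rule ennreal_leI)
    also have "\<dots> = ennreal (\<beta> (dist_L (x 0) (y 0)) t) + ennreal ?I"
      using dist_L_nonneg[of "x 0" "y 0"] B(4)[THEN spec, of t] u w'
      by (intro ennreal_plus add_nonneg_nonneg Henstock_Kurzweil_Integration.integral_nonneg)
         (auto simp: \<beta>_def intro: mult_nonneg_nonneg less_imp_le)
    also have "ennreal ?I = set_nn_integral lborel {0..t} (\<lambda>s. ennreal (?u s + ?w s))"
      by (intro nn_integral_has_integral_lebesgue'[symmetric] has_integral_add integrable_integral u w') auto
    finally show ?thesis
    proof (rule order_trans, intro add_left_mono)
      show "set_nn_integral lborel {0..t} (\<lambda>s. ennreal (?u s + ?w s))
          \<le> set_nn_integral lborel {0..t} (\<lambda>s. ennreal (\<gamma> (norm (u (y s) s, w s))))"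
        by (intro nn_integral_mono mult_right_mono ennreal_leI sum_le) simp
    qed
  next
    case False
    then show ?thesis by (simp add: top.not_eq_extremum[symmetric])
  qed
  ultimately show ?thesis unfolding SiISS_def
    by (intro exI[of _ \<beta>] exI[of _ \<gamma>] conjI allI impI)
qed

section \<open>Peano's theorem for measurable time dependence\<close>

lemma bounded_measurable_integrable_on:
  fixes f :: "real \<Rightarrow> 'a::euclidean_space"
  assumes "f \<in> borel_measurable borel" "\<And>s. norm (f s) \<le> M"
  shows "f integrable_on {p..q}"
proof (rule measurable_bounded_by_integrable_imp_integrable)
  show "f \<in> borel_measurable (lebesgue_on {p..q})"
    using assms(1) by (intro measurable_restrict_space1 measurable_completion) auto
  show "(\<lambda>_. M) integrable_on {p..q}" by (rule integrable_const_ivl)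
qed (use assms in auto)

text \<open>Euler polygons \<open>X n\<close> follow \<open>F\<close> with the state frozen at the
  left end of each cell of length \<open>h n\<close>. They are uniformly \<open>M\<close>-Lipschitz,
  so Arzela-Ascoli yields a uniformly convergent subsequence, and dominated convergence passes to
  the limit in the integral equation.\<close>

lemma peano_existence_globally_bounded:
  fixes F :: "real \<Rightarrow> 'a::euclidean_space \<Rightarrow> 'a"
  assumes meas: "\<And>g. g \<in> borel_measurable borel \<Longrightarrow> (\<lambda>s. F s (g s)) \<in> borel_measurable borel"
    and cont: "\<And>s. continuous_on UNIV (F s)"
    and bound: "\<And>s x. norm (F s x) \<le> M"
  obtains x where "\<And>t. c \<le> t \<Longrightarrow> t \<le> d \<Longrightarrow> ((\<lambda>s. F s (x s)) has_integral (x t - x0)) {c..t}"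
proof -
  define h :: "nat \<Rightarrow> real" where "h n = 1 / Suc n" for n
  have h: "0 < h n" for n by (simp add: h_def)
  define v where "v n = rec_nat x0 (\<lambda>k w. w + integral {c + k * h n..c + Suc k * h n} (\<lambda>s. F s w))" for n
  have v0: "v n 0 = x0"
    and vSuc: "v n (Suc k) = v n k + integral {c + k * h n..c + Suc k * h n} (\<lambda>s. F s (v n k))" for n k
    by (simp_all add: v_def)
  define k where "k n s = nat \<lfloor>(s - c) / h n\<rfloor>" for n s
  define G where "G n s = F s (v n (k n s))" for n s
  define X where "X n t = x0 + integral {c..t} (G n)" for n t
  have M: "0 \<le> M" using bound[of 0 0] norm_ge_zero order_trans by blast
  have k_bounds: "c + k n s * h n \<le> s" "s < c + Suc (k n s) * h n" if "c \<le> s" for n s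
  proof -
    have "0 \<le> (s - c) / h n" using that h[of n] by simp
    then have "real (k n s) \<le> (s - c) / h n" "(s - c) / h n < real (k n s) + 1"
      unfolding k_def by linarith+
    then show "c + k n s * h n \<le> s" "s < c + Suc (k n s) * h n"
      using h[of n] by (simp_all add: field_simps)
  qed
  have G_meas: "G n \<in> borel_measurable borel" for n
  proof -
    have "(\<lambda>s. nat \<lfloor>(s - c) / h n\<rfloor>) \<in> measurable borel (count_space UNIV)" by measurable
    then have "(\<lambda>s. v n (nat \<lfloor>(s - c) / h n\<rfloor>)) \<in> borel_measurable borel"
      by (rule measurable_compose) simp
    then show ?thesis unfolding G_def k_def by (rule meas)
  qed
  have G_bound: "norm (G n s) \<le> M" for n s by (simp add: G_def bound)
  have G_int: "G n integrable_on {p..q}" for n p q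
    by (rule bounded_measurable_integrable_on[OF G_meas G_bound])
  have X_diff: "X n q - X n p = integral {p..q} (G n)" if "c \<le> p" "p \<le> q" for n p q
  proof -
    have "integral {c..p} (G n) + integral {p..q} (G n) = integral {c..q} (G n)"
      using that by (intro Henstock_Kurzweil_Integration.integral_combine G_int) auto
    then show ?thesis by (simp add: X_def algebra_simps)
  qed
  have X_lip: "norm (X n q - X n p) \<le> M * (q - p)" if "c \<le> p" "p \<le> q" for n p q
  proof -
    have "norm (integral {p..q} (G n)) \<le> integral {p..q} (\<lambda>_. M)"
      using G_int G_bound by (intro Henstock_Kurzweil_Integration.integral_norm_bound_integral) auto
    then show ?thesis using X_diff[OF that] that by (simp add: mult.commute)
  qed
  have X_grid: "X n (c + j * h n) = v n j" for n j
  proof (induction j)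
    case 0
    show ?case by (simp add: X_def v0)
  next
    case (Suc j)
    have le: "c + j * h n \<le> c + Suc j * h n" "c \<le> c + j * h n" using h[of n] by simp_all
    have "integral {c + j * h n..c + Suc j * h n} (G n)
        = integral {c + j * h n..c + Suc j * h n} (\<lambda>s. F s (v n j))"
    \<comment> \<open>The right endpoint already belongs to the next cell; a single point does not
      affect the integral.\<close>
    proof (rule integral_spike[of "{c + Suc j * h n}"])
      fix s assume "s \<in> {c + j * h n..c + Suc j * h n} - {c + Suc j * h n}"
      then have s: "c + j * h n \<le> s" "s < c + Suc j * h n" by auto
      have "real j \<le> (s - c) / h n" "(s - c) / h n < real j + 1"
        using s h[of n] by (simp_all add: field_simps)
      then have "k n s = j" unfolding k_def by linarith
      then show "F s (v n j) = G n s" by (simp add: G_def)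
    qed simp
    then show ?case using X_diff[OF le(2,1), of n] Suc by (simp add: vSuc algebra_simps)
  qed
  have X_v: "norm (v n (k n s) - X n s) \<le> M * h n" if "c \<le> s" for n s
  proof -
    have "norm (X n s - X n (c + k n s * h n)) \<le> M * (s - (c + k n s * h n))"
      using k_bounds[OF that] h[of n] by (intro X_lip) auto
    also have "\<dots> \<le> M * h n" using k_bounds[OF that, of n] M by (intro mult_left_mono) (auto simp: algebra_simps)
    finally show ?thesis by (simp add: X_grid norm_minus_commute)
  qed
  obtain g r where g: "strict_mono (r :: nat \<Rightarrow> nat)"
    "\<And>e. 0 < e \<Longrightarrow> \<exists>N. \<forall>n s. n \<ge> N \<and> s \<in> {c..d} \<longrightarrow> norm (X (r n) s - g s) < e"
  proof (rule Arzela_Ascoli[of "{c..d}" X "norm x0 + M * (d - c)"])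
    show "norm (X n s) \<le> norm x0 + M * (d - c)" if "s \<in> {c..d}" for n s
    proof -
      have "X n c = x0" by (simp add: X_def)
      then have "norm (X n s) \<le> norm x0 + norm (X n s - X n c)"
        using norm_triangle_ineq[of x0 "X n s - x0"] by simp
      also have "norm (X n s - X n c) \<le> M * (s - c)" using that by (intro X_lip) auto
      also have "\<dots> \<le> M * (d - c)" using that M by (intro mult_left_mono) auto
      finally show ?thesis by simp
    qed
    show "\<exists>\<delta>>0. \<forall>n y. y \<in> {c..d} \<and> norm (s - y) < \<delta> \<longrightarrow> norm (X n s - X n y) < e"
      if s: "s \<in> {c..d}" and e: "0 < e" for s e
    proof (intro exI[of _ "e / (M + 1)"] conjI allI impI)
      show "0 < e / (M + 1)" using M e by simp
      fix n y assume y: "y \<in> {c..d} \<and> norm (s - y) < e / (M + 1)"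
      have "norm (X n s - X n y) \<le> M * norm (s - y)"
        using X_lip[of s y n] X_lip[of y s n] s y by (cases "s \<le> y") (auto simp: norm_minus_commute)
      also have "\<dots> \<le> (M + 1) * norm (s - y)" by (intro mult_right_mono) auto
      also have "\<dots> < e" using y M by (simp add: field_simps)
      finally show "norm (X n s - X n y) < e" .
    qed
  qed auto
  have hr: "(\<lambda>n. h (r n)) \<longlonglongrightarrow> 0"
    using LIMSEQ_subseq_LIMSEQ[OF LIMSEQ_inverse_real_of_nat g(1)]
    by (simp add: h_def o_def inverse_eq_divide)
  have X_lim: "(\<lambda>n. X (r n) s) \<longlonglongrightarrow> g s" if "s \<in> {c..d}" for s
    unfolding LIMSEQ_iff using g(2) that by meson
  have v_lim: "(\<lambda>n. v (r n) (k (r n) s)) \<longlonglongrightarrow> g s" if "s \<in> {c..d}" for s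
  proof -
    have "(\<lambda>n. v (r n) (k (r n) s) - X (r n) s) \<longlonglongrightarrow> 0"
    proof (rule tendsto_0_le[where K = M, OF hr], intro always_eventually allI)
      show "norm (v (r n) (k (r n) s) - X (r n) s) \<le> norm (h (r n)) * M" for n
        using X_v[of s "r n"] that h[of "r n"] by (simp add: mult.commute)
    qed
    from tendsto_add[OF this X_lim[OF that]] show ?thesis by simp
  qed
  show ?thesis
  proof (rule that)
    fix t assume t: "c \<le> t" "t \<le> d"
    show "((\<lambda>s. F s (g s)) has_integral (g t - x0)) {c..t}"
    proof (rule has_integral_dominated_convergence)
      show "(G (r n) has_integral (X (r n) t - x0)) {c..t}" for n
        using G_int by (simp add: X_def integrable_integral)
      show "(\<lambda>_. M) integrable_on {c..t}" by (rule integrable_const_ivl)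
      show "\<forall>s\<in>{c..t}. norm (G (r n) s) \<le> M" for n using G_bound by blast
      show "\<forall>s\<in>{c..t}. (\<lambda>n. G (r n) s) \<longlonglongrightarrow> F s (g s)"
      proof
        fix s assume "s \<in> {c..t}"
        then have "s \<in> {c..d}" using t by simp
        then show "(\<lambda>n. G (r n) s) \<longlonglongrightarrow> F s (g s)"
          unfolding G_def using cont[of s] v_lim
          by (intro continuous_on_tendsto_compose[of UNIV "F s"]) auto
      qed
      show "(\<lambda>n. X (r n) t - x0) \<longlonglongrightarrow> g t - x0"
        using X_lim[of t] t by (intro tendsto_diff tendsto_const) auto
    qed
  qed
qed

text \<open>Setting \<open>F\<close> to 0 outside \<open>{c..d}\<close> makes the bound
  global.\<close>

lemma peano_existence:
  fixes F :: "real \<Rightarrow> 'a::euclidean_space \<Rightarrow> 'a"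
  assumes meas: "\<And>g. g \<in> borel_measurable borel \<Longrightarrow> (\<lambda>s. F s (g s)) \<in> borel_measurable borel"
    and cont: "\<And>s. continuous_on UNIV (F s)"
    and bound: "\<And>s x. c \<le> s \<Longrightarrow> s \<le> d \<Longrightarrow> norm (F s x) \<le> M"
    and cd: "c \<le> d"
  obtains x where "x c = x0"
    "\<And>t. c \<le> t \<Longrightarrow> t \<le> d \<Longrightarrow> ((\<lambda>s. F s (x s)) has_integral (x t - x0)) {c..t}"
proof -
  define F' where "F' s x = (if s \<in> {c..d} then F s x else 0)" for s x
  have M: "0 \<le> M" using bound[of c 0] cd norm_ge_zero order_trans by blast
  have "(\<lambda>s. F' s (g s)) \<in> borel_measurable borel" if "g \<in> borel_measurable borel" for g
    unfolding F'_def using meas[OF that] by measurable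
  moreover have "continuous_on UNIV (F' s)" for s
    unfolding F'_def using cont[of s]
    by (cases "s \<in> {c..d}") (simp_all only: if_True if_False continuous_on_const)
  moreover have "norm (F' s x) \<le> M" for s x
    unfolding F'_def using bound M by simp
  ultimately obtain x where x: "\<And>t. c \<le> t \<Longrightarrow> t \<le> d \<Longrightarrow> ((\<lambda>s. F' s (x s)) has_integral (x t - x0)) {c..t}"
    using peano_existence_globally_bounded[of F' M c d x0] by blast
  have "((\<lambda>s. F' s (x s)) has_integral 0) {c..c}" by (simp add: has_integral_refl)
  then have "x c - x0 = 0" using x[OF order_refl cd] by (rule has_integral_unique[symmetric])
  show ?thesis
  proof (rule that)
    show "x c = x0" using \<open>x c - x0 = 0\<close> by simp
    show "((\<lambda>s. F s (x s)) has_integral (x t - x0)) {c..t}" if "c \<le> t" "t \<le> d" for t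
      by (rule has_integral_eq[OF _ x[OF that]]) (use that in \<open>auto simp: F'_def\<close>)
  qed
qed

text \<open>Solutions on successive unit intervals are glued, so the bound may grow with
  time.\<close>

lemma peano_existence_global:
  fixes F :: "real \<Rightarrow> 'a::euclidean_space \<Rightarrow> 'a"
  assumes meas: "\<And>g. g \<in> borel_measurable borel \<Longrightarrow> (\<lambda>s. F s (g s)) \<in> borel_measurable borel"
    and cont: "\<And>s. continuous_on UNIV (F s)"
    and bound: "\<And>T. \<exists>M. \<forall>s x. 0 \<le> s \<longrightarrow> s \<le> T \<longrightarrow> norm (F s x) \<le> M"
  obtains x where "x 0 = x0" "\<And>t. 0 \<le> t \<Longrightarrow> ((\<lambda>s. F s (x s)) has_integral (x t - x 0)) {0..t}"
proof -
  define sol where "sol n x \<longleftrightarrow>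
    (\<forall>t. real n \<le> t \<longrightarrow> t \<le> real (Suc n) \<longrightarrow> ((\<lambda>s. F s (x s)) has_integral (x t - x (real n))) {real n..t})" for n x
  have ex: "\<exists>x. sol n x \<and> x (real n) = z" for n z
  proof -
    obtain M where M: "\<And>s x. 0 \<le> s \<Longrightarrow> s \<le> real (Suc n) \<Longrightarrow> norm (F s x) \<le> M"
      using bound[of "real (Suc n)"] by blast
    show ?thesis
    proof (rule peano_existence[of F "real n" "real (Suc n)" M z])
      fix x assume "x (real n) = z"
        and "\<And>t. real n \<le> t \<Longrightarrow> t \<le> real (Suc n) \<Longrightarrow> ((\<lambda>s. F s (x s)) has_integral (x t - z)) {real n..t}"
      then show ?thesis unfolding sol_def by (intro exI[of _ x]) simp
    qed (use meas cont M in auto)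
  qed
  \<comment> \<open>Solutions need not be unique, so each piece is chosen depending on the endpoint
    of the one before.\<close>
  have "\<exists>X. \<forall>n. (sol n (X n) \<and> (n = 0 \<longrightarrow> X n 0 = x0)) \<and> X (Suc n) (real (Suc n)) = X n (real (Suc n))"
  proof (rule dependent_nat_choice)
    show "\<exists>x. sol 0 x \<and> (0 = (0::nat) \<longrightarrow> x 0 = x0)" using ex[of 0 x0] by simp
    show "\<exists>x'. (sol (Suc n) x' \<and> (Suc n = 0 \<longrightarrow> x' 0 = x0)) \<and> x' (real (Suc n)) = x (real (Suc n))" for x n
      using ex[of "Suc n" "x (real (Suc n))"] by blast
  qed
  then obtain X where
    "\<forall>n. (sol n (X n) \<and> (n = 0 \<longrightarrow> X n 0 = x0)) \<and> X (Suc n) (real (Suc n)) = X n (real (Suc n))"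
    by (rule exE)
  then have X: "sol n (X n)" "X 0 0 = x0" "X (Suc n) (real (Suc n)) = X n (real (Suc n))" for n
    by blast+
  define x where "x t = X (nat \<lfloor>t\<rfloor>) t" for t
  have x_eq: "x t = X n t" if "real n \<le> t" "t \<le> real (Suc n)" for n t
  proof (cases "t = real (Suc n)")
    case False
    then have "nat \<lfloor>t\<rfloor> = n" using that by linarith
    then show ?thesis by (simp add: x_def)
  qed (simp add: x_def X(3) del: of_nat_Suc)
  have seg: "((\<lambda>s. F s (x s)) has_integral (x t - x (real n))) {real n..t}"
    if "real n \<le> t" "t \<le> real (Suc n)" for n t
  proof -
    have "((\<lambda>s. F s (X n s)) has_integral (X n t - X n (real n))) {real n..t}"
      using X(1)[of n] that unfolding sol_def by blast
    then have "((\<lambda>s. F s (x s)) has_integral (X n t - X n (real n))) {real n..t}"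
      by (rule has_integral_eq[rotated]) (use x_eq[of n] that in auto)
    then show ?thesis using x_eq[of n] that by simp
  qed
  have whole: "((\<lambda>s. F s (x s)) has_integral (x (real n) - x 0)) {0..real n}" for n
  proof (induction n)
    case (Suc n)
    show ?case
      using has_integral_combine[OF _ _ Suc seg[of n "real (Suc n)"]] by (simp add: algebra_simps)
  qed (simp add: has_integral_refl)
  show ?thesis
  proof (rule that)
    show "x 0 = x0" using X(2) by (simp add: x_def)
    fix t :: real assume t: "0 \<le> t"
    let ?n = "nat \<lfloor>t\<rfloor>"
    have n: "real ?n \<le> t" "t \<le> real (Suc ?n)" using t by linarith+
    show "((\<lambda>s. F s (x s)) has_integral (x t - x 0)) {0..t}"
      using has_integral_combine[OF _ n(1) whole seg[OF n]] by (simp add: algebra_simps)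
  qed
qed

section \<open>Stable networks are jointly connected\<close>

text \<open>The weights \<open>b\<close> may be unbounded; clipping every coordinate to [0, 1] makes the right-hand
  side locally bounded, and solutions started in the cube turn out never to notice the clipping.\<close>

definition saturate :: "real^'d^'n \<Rightarrow> real^'d^'n" where
  "saturate x = (\<chi> i l. max 0 (min 1 (x $ i $ l)))"

lemma saturate_nth: "saturate x $ i $ l = max 0 (min 1 (x $ i $ l))"
  by (simp add: saturate_def)

lemma saturate_eq: "(\<And>i l. 0 \<le> x $ i $ l \<and> x $ i $ l \<le> 1) \<Longrightarrow> saturate x = x"
  by (simp add: vec_eq_iff saturate_nth)

lemma continuous_on_saturate:
  fixes f :: "'a::topological_space \<Rightarrow> real^'d::finite^'n::finite"
  assumes "continuous_on S f"
  shows "continuous_on S (\<lambda>p. saturate (f p))"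
  unfolding saturate_def
  by (intro continuous_on_vec_lambda continuous_intros assms)

lemma norm_saturate_le:
  "norm (saturate x :: real^'d::finite^'n::finite) \<le> real CARD('n) * real CARD('d)"
proof -
  have "norm (saturate x $ i) \<le> real CARD('d)" for i
  proof -
    have "norm (saturate x $ i) \<le> (\<Sum>l\<in>UNIV. \<bar>saturate x $ i $ l\<bar>)" by (rule norm_le_l1_cart)
    also have "\<dots> \<le> (\<Sum>l\<in>(UNIV::'d set). 1)" by (intro sum_mono) (simp add: saturate_nth)
    finally show ?thesis by simp
  qed
  then have "(\<Sum>i\<in>(UNIV::'n set). norm (saturate x $ i)) \<le> (\<Sum>i\<in>(UNIV::'n set). real CARD('d))"
    by (intro sum_mono)
  moreover have "norm (saturate x) \<le> (\<Sum>i\<in>UNIV. norm (saturate x $ i))"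
    unfolding norm_vec_def by (intro L2_set_le_sum) simp
  ultimately show ?thesis by simp
qed

lemma infdist_leader_hull_0: "infdist z (leader_hull 0) = norm z"
  by (simp add: leader_hull_def infdist_def)

lemma follower_rhs_nth:
  "follower_rhs \<sigma> a b (\<lambda>_. 0) x 0 t $ i $ l =
     (\<Sum>j\<in>N_set (\<sigma> t) i. a i j x 0 t * (x $ j $ l - x $ i $ l))
   - (\<Sum>m\<in>L_set (\<sigma> t) i. b i m x 0 t * x $ i $ l)"
  by (simp add: follower_rhs_def sum_negf)

section \<open>Zero-input solutions in the unit cube and the contradiction drawn from them\<close>

context switched_network
begin

lemma continuous_on_a: "continuous_on S (\<lambda>p. a i j (f p) (g p) (h p))"
  if "continuous_on S f" "continuous_on S g" "continuous_on S h"
  using continuous_on_compose2[OF a_cont continuous_on_Pair[OF that(1) continuous_on_Pair[OF that(2,3)]], of i j]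
  by simp

lemma continuous_on_b: "continuous_on S (\<lambda>p. b i l (f p) (g p) (h p))"
  if "continuous_on S f" "continuous_on S g" "continuous_on S h"
  using continuous_on_compose2[OF b_cont continuous_on_Pair[OF that(1) continuous_on_Pair[OF that(2,3)]], of i l]
  by simp

text \<open>With the digraph frozen to \<open>E\<close> no switching remains. Measurability and
  boundedness follow by combining the finitely many modes.\<close>

lemma continuous_on_mode_rhs:
  assumes "continuous_on S f" "continuous_on S g"
  shows "continuous_on S (\<lambda>p. follower_rhs (\<lambda>_. E) a b (\<lambda>_. 0) (f p) 0 (g p))"
  unfolding follower_rhs_def
  by (intro continuous_on_vec_lambda continuous_intros continuous_on_a continuous_on_b assms)

lemma follower_rhs_mode:
  "follower_rhs \<sigma> a b w x y t = follower_rhs (\<lambda>_. \<sigma> t) a b w x y t"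
  by (simp add: follower_rhs_def)

text \<open>The value 0 at negative times is a default: the dwell-time condition says nothing about
  \<open>\<sigma>\<close> there.\<close>

definition saturated_rhs :: "real \<Rightarrow> real^'d^'n \<Rightarrow> real^'d^'n" where
  "saturated_rhs t x = (if 0 \<le> t then follower_rhs \<sigma> a b (\<lambda>_. 0) (saturate x) 0 t else 0)"

text \<open>The right-hand side is a finite sum over modes of a measurable indicator times a
  continuous function composed with \<open>g\<close>.\<close>

lemma saturated_rhs_measurable:
  assumes "g \<in> borel_measurable borel"
  shows "(\<lambda>s. saturated_rhs s (g s)) \<in> borel_measurable borel"
proof -
  let ?f = "\<lambda>E s. follower_rhs (\<lambda>_. E) a b (\<lambda>_. 0) (saturate (g s)) 0 s"
  have "(\<lambda>p. follower_rhs (\<lambda>_. E) a b (\<lambda>_. 0) (saturate (snd p)) 0 (fst p)) \<in> borel_measurable borel" for E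
    by (intro borel_measurable_continuous_onI continuous_on_mode_rhs continuous_on_saturate continuous_intros)
  moreover have "(\<lambda>s. (s, g s)) \<in> borel_measurable borel"
    using assms by (intro borel_measurable_Pair) auto
  ultimately have "?f E \<in> borel_measurable borel" for E
    using measurable_compose[of "\<lambda>s. (s, g s)" borel borel
      "\<lambda>p. follower_rhs (\<lambda>_. E) a b (\<lambda>_. 0) (saturate (snd p)) 0 (fst p)" borel] by simp
  then have "(\<lambda>s. \<Sum>E\<in>UNIV. indicator {t. 0 \<le> t \<and> \<sigma> t = E} s *\<^sub>R ?f E s) \<in> borel_measurable borel"
    using dwell_time_measurable[OF dwell]
    by (intro borel_measurable_sum borel_measurable_scaleR borel_measurable_indicator) auto
  moreover have "(\<Sum>E\<in>UNIV. indicator {t. 0 \<le> t \<and> \<sigma> t = E} s *\<^sub>R ?f E s) = saturated_rhs s (g s)" for s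
  proof (cases "0 \<le> s")
    case True
    have "(\<Sum>E\<in>UNIV. indicator {t. 0 \<le> t \<and> \<sigma> t = E} s *\<^sub>R ?f E s)
        = (\<Sum>E\<in>{\<sigma> s}. indicator {t. 0 \<le> t \<and> \<sigma> t = E} s *\<^sub>R ?f E s)"
      by (intro sum.mono_neutral_right) auto
    then show ?thesis using True by (simp add: saturated_rhs_def follower_rhs_mode[of _ _ _ s])
  qed (simp add: saturated_rhs_def)
  ultimately show ?thesis by simp
qed

text \<open>Saturated states lie in a fixed ball, so up to time \<open>T\<close> all values lie in a
  finite union of continuous images of a compact set.\<close>

lemma saturated_rhs_bounded: "\<exists>M. \<forall>s x. 0 \<le> s \<longrightarrow> s \<le> T \<longrightarrow> norm (saturated_rhs s x) \<le> M"
proof -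
  let ?f = "\<lambda>E p. follower_rhs (\<lambda>_. E) a b (\<lambda>_. 0) (snd p) 0 (fst p)"
  let ?K = "{0..T} \<times> cball (0 :: real^'d^'n) (real CARD('n) * real CARD('d))"
  have "compact (\<Union>E\<in>UNIV. ?f E ` ?K)"
    by (intro compact_UN compact_continuous_image continuous_on_mode_rhs compact_Times
        continuous_intros) auto
  then have "\<exists>M. \<forall>z\<in>(\<Union>E\<in>UNIV. ?f E ` ?K). norm z \<le> M"
    by (intro compact_imp_bounded bounded_iff[THEN iffD1])
  then obtain M where M: "\<forall>z\<in>(\<Union>E\<in>UNIV. ?f E ` ?K). norm z \<le> M"
    by (rule exE)
  have "norm (saturated_rhs s x) \<le> M" if "0 \<le> s" "s \<le> T" for s x
  proof -
    have "saturate x \<in> cball 0 (real CARD('n) * real CARD('d))"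
      unfolding mem_cball_0 by (rule norm_saturate_le)
    then have "?f (\<sigma> s) (s, saturate x) \<in> (\<Union>E\<in>UNIV. ?f E ` ?K)"
      using that by (intro UN_I[of "\<sigma> s"] imageI) auto
    then have "norm (?f (\<sigma> s) (s, saturate x)) \<le> M" by (rule M[rule_format])
    then show ?thesis using that by (simp add: saturated_rhs_def follower_rhs_mode[of _ _ _ s])
  qed
  then show ?thesis by (intro exI[of _ M] allI impI)
qed

text \<open>Peano's theorem applies to the saturated system. Barriers at 1 and 0 keep every
  coordinate in the unit interval, where saturation is the identity.\<close>

lemma zero_input_solution:
  obtains x where "sys5_solution \<sigma> a b (\<lambda>_ _. 0) (\<lambda>_. 0) x (\<lambda>_. 0)"
    "x 0 = (\<chi> i l. 1)" "\<forall>t\<ge>0. \<forall>i l. 0 \<le> x t $ i $ l"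
proof -
  obtain x where x0: "x 0 = (\<chi> i l. 1)"
    and x: "\<And>t. 0 \<le> t \<Longrightarrow> ((\<lambda>s. saturated_rhs s (x s)) has_integral (x t - x 0)) {0..t}"
  proof (rule peano_existence_global[of saturated_rhs "\<chi> i l. 1"])
    show "continuous_on UNIV (saturated_rhs s)" for s
    proof (cases "0 \<le> s")
      case True
      have "continuous_on UNIV (\<lambda>x. follower_rhs (\<lambda>_. \<sigma> s) a b (\<lambda>_. 0) (saturate x) 0 s)"
        by (intro continuous_on_mode_rhs continuous_on_saturate continuous_intros)
      then show ?thesis using True by (simp add: saturated_rhs_def[abs_def] follower_rhs_mode[of _ _ _ s])
    qed (simp add: saturated_rhs_def[abs_def])
  qed (use saturated_rhs_measurable saturated_rhs_bounded in auto)
  have cont: "continuous_on {0..t} (\<lambda>s. x s $ i $ l)" for t i l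
    by (intro continuous_intros has_integral_imp_continuous_on[OF x])
  have inc: "((\<lambda>s. saturated_rhs s (x s) $ i $ l) has_integral (x t $ i $ l - x s $ i $ l)) {s..t}"
    if "0 \<le> s" "s \<le> t" for s t i l
  proof -
    have "bounded_linear (\<lambda>v::real^'d^'n. v $ i $ l)"
      by (rule bounded_linear_compose[OF bounded_linear_vec_nth bounded_linear_vec_nth])
    from has_integral_linear[OF has_integral_increment[OF x that] this] show ?thesis
      by (simp add: o_def)
  qed
  \<comment> \<open>While the coordinate is at least 1, its saturated value is the maximal value 1,
    so neither followers nor leaders at 0 can push it up. The lower barrier is symmetric.\<close>
  have up: "x t $ i $ l \<le> 1" if t: "0 \<le> t" for t i l
  proof (rule barrier[OF cont t])
    fix s assume s: "0 \<le> s" "s \<le> t" and ge: "\<And>r. s \<le> r \<Longrightarrow> r \<le> t \<Longrightarrow> 1 \<le> x r $ i $ l"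
    have rate: "saturated_rhs r (x r) $ i $ l \<le> 0" if r: "r \<in> {s..t}" for r
    proof -
      have "saturate (x r) $ i $ l = 1" "saturate (x r) $ j $ l \<le> 1" for j
        using ge[of r] r by (auto simp: saturate_nth)
      then have "a i j (saturate (x r)) 0 r * (saturate (x r) $ j $ l - saturate (x r) $ i $ l) \<le> 0"
        "0 \<le> b i m (saturate (x r)) 0 r * saturate (x r) $ i $ l" for j m
        using less_imp_le[OF less_le_trans[OF rate_pos rate_a]] less_imp_le[OF less_le_trans[OF rate_pos rate_b]]
        by (auto intro: mult_nonneg_nonpos mult_nonneg_nonneg)
      then show ?thesis
        using r s by (auto simp: saturated_rhs_def follower_rhs_nth
          intro!: order_trans[OF sum_nonpos sum_nonneg])
    qed
    have "x t $ i $ l - x s $ i $ l \<le> 0"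
      by (intro has_integral_le[OF inc[OF s] has_integral_0 rate])
    then show "x t $ i $ l \<le> x s $ i $ l" by simp
  qed (simp add: x0)
  have low: "- (x t $ i $ l) \<le> 0" if t: "0 \<le> t" for t i l
  proof (rule barrier[OF continuous_on_minus[OF cont] t])
    fix s assume s: "0 \<le> s" "s \<le> t" and ge: "\<And>r. s \<le> r \<Longrightarrow> r \<le> t \<Longrightarrow> 0 \<le> - (x r $ i $ l)"
    have rate: "0 \<le> saturated_rhs r (x r) $ i $ l" if r: "r \<in> {s..t}" for r
    proof -
      have i0: "saturate (x r) $ i $ l = 0" and "0 \<le> saturate (x r) $ j $ l" for j
        using ge[of r] r by (auto simp: saturate_nth)
      then have "0 \<le> a i j (saturate (x r)) 0 r * (saturate (x r) $ j $ l)" for j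
        using less_imp_le[OF less_le_trans[OF rate_pos rate_a]] by simp
      then show ?thesis
        using r s by (auto simp: saturated_rhs_def follower_rhs_nth i0 intro!: sum_nonneg)
    qed
    have "0 \<le> x t $ i $ l - x s $ i $ l"
      by (intro has_integral_le[OF has_integral_0 inc[OF s] rate])
    then show "- (x t $ i $ l) \<le> - (x s $ i $ l)" by simp
  qed (simp add: x0)
  have "saturate (x t) = x t" if "0 \<le> t" for t
    using up[OF that] low[OF that] by (intro saturate_eq) simp
  then have "((\<lambda>s. follower_rhs \<sigma> a b (\<lambda>_. 0) (x s) 0 s) has_integral (x t - x 0)) {0..t}" if "0 \<le> t" for t
    by (intro has_integral_eq[OF _ x[OF that]]) (simp add: saturated_rhs_def)
  then have "sys5_solution \<sigma> a b (\<lambda>_ _. 0) (\<lambda>_. 0) x (\<lambda>_. 0)"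
    by (simp add: sys5_solution_def)
  moreover have "\<forall>t\<ge>0. \<forall>i l. 0 \<le> x t $ i $ l" using low by auto
  ultimately show ?thesis using that x0 by blast
qed

text \<open>A coordinate of an unreachable follower stays above a fixed \<open>c > 0\<close>,
  whereas with zero inputs \<open>\<beta>\<close> would force the distance to 0.\<close>

lemma SiISS_imp_JLC:
  assumes "SiISS \<sigma> a b"
  shows "JLC \<sigma>"
proof (rule ccontr)
  assume "\<not> JLC \<sigma>"
  then obtain t0 i0 where t0: "0 \<le> t0" and i0: "\<And>m. (Inr m, Inl i0) \<notin> (joint_graph \<sigma> {t0..})\<^sup>+"
    unfolding JLC_def L_connected_def by blast
  \<comment> \<open>After \<open>t0\<close> the set \<open>A\<close> is closed under in-neighbours
    and receives nothing from leaders, so it evolves on its own.\<close>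
  define A where "A = {i. \<forall>m. (Inr m, Inl i) \<notin> (joint_graph \<sigma> {t0..})\<^sup>+}"
  have arc: "e \<in> joint_graph \<sigma> {t0..}" if "e \<in> \<sigma> t" "t0 \<le> t" for e t
    using that by (auto simp: joint_graph_def)
  have A_L: "L_set (\<sigma> t) i = {}" if "t0 \<le> t" "i \<in> A" for t i
    using that arc r_into_trancl unfolding A_def L_set_def by fast
  have A_N: "j \<in> A" if "t0 \<le> t" "i \<in> A" "j \<in> N_set (\<sigma> t) i" for t i j
    using that arc trancl_into_trancl unfolding A_def N_set_def by fast
  obtain x where sol: "sys5_solution \<sigma> a b (\<lambda>_ _. 0) (\<lambda>_. 0) x (\<lambda>_. 0)"
    and x0: "x 0 = (\<chi> i l. 1)" and nonneg: "\<forall>t\<ge>0. \<forall>i l. 0 \<le> x t $ i $ l"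
    by (rule zero_input_solution)
  let ?rhs = "\<lambda>s. follower_rhs \<sigma> a b (\<lambda>_. 0) (x s) 0 s"
  have x: "(?rhs has_integral (x t - x 0)) {0..t}" if "0 \<le> t" for t
    using sol that by (simp add: sys5_solution_def)
  have cx: "continuous_on {0..t} x" for t by (rule has_integral_imp_continuous_on[OF x])
  have cont: "continuous_on {s..t} (\<lambda>s. x s $ i $ l)" if "0 \<le> s" for s t i l
    using that by (intro continuous_intros continuous_on_subset[OF cx[of t]]) auto
  have inc: "((\<lambda>s. ?rhs s $ i $ l) has_integral (x t $ i $ l - x s $ i $ l)) {s..t}"
    if "0 \<le> s" "s \<le> t" for s t i l
  proof -
    have "bounded_linear (\<lambda>v::real^'d^'n. v $ i $ l)"
      by (rule bounded_linear_compose[OF bounded_linear_vec_nth bounded_linear_vec_nth])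
    from has_integral_linear[OF has_integral_increment[OF x that] this] show ?thesis
      by (simp add: o_def)
  qed
  have a_nonneg: "0 \<le> a i j p q t" and b_nonneg: "0 \<le> b i m p q t" for i j m p q t
    using less_imp_le[OF less_le_trans[OF rate_pos rate_a]] less_imp_le[OF less_le_trans[OF rate_pos rate_b]]
    by auto
  \<comment> \<open>The total weight along this solution bounds the decay of each coordinate.
    Continuity on a compact interval makes it finite even for unbounded \<open>b\<close>.\<close>
  define C where "C s = (\<Sum>i\<in>UNIV. (\<Sum>j\<in>UNIV. a i j (x s) 0 s) + (\<Sum>m\<in>UNIV. b i m (x s) 0 s))" for s
  have "continuous_on {0..t0} C"
    unfolding C_def by (intro continuous_intros continuous_on_a continuous_on_b cx)
  then have "bounded (C ` {0..t0})"
    by (intro compact_imp_bounded compact_continuous_image) auto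
  then obtain K where "\<forall>v\<in>C ` {0..t0}. norm v \<le> K"
    unfolding bounded_iff by blast
  then have K: "C s \<le> K" if "0 \<le> s" "s \<le> t0" for s
    using that by (auto intro: abs_le_D1)
  \<comment> \<open>Neighbours with nonnegative coordinates pull no harder than leaders at
    0.\<close>
  have rhs_ge: "- K * x s $ i $ l \<le> ?rhs s $ i $ l" if s: "0 \<le> s" "s \<le> t0" for s i l
  proof -
    let ?xi = "x s $ i $ l"
    have "(\<Sum>j\<in>N_set (\<sigma> s) i. a i j (x s) 0 s) + (\<Sum>m\<in>L_set (\<sigma> s) i. b i m (x s) 0 s)
        \<le> (\<Sum>j\<in>UNIV. a i j (x s) 0 s) + (\<Sum>m\<in>UNIV. b i m (x s) 0 s)"
      by (intro add_mono sum_mono2) (auto simp: a_nonneg b_nonneg)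
    also have "\<dots> \<le> C s"
      unfolding C_def by (rule member_le_sum) (auto intro!: add_nonneg_nonneg sum_nonneg simp: a_nonneg b_nonneg)
    also have "\<dots> \<le> K" by (rule K[OF s])
    finally have "((\<Sum>j\<in>N_set (\<sigma> s) i. a i j (x s) 0 s) + (\<Sum>m\<in>L_set (\<sigma> s) i. b i m (x s) 0 s)) * ?xi \<le> K * ?xi"
      using nonneg s by (intro mult_right_mono) auto
    moreover have "(\<Sum>j\<in>N_set (\<sigma> s) i. a i j (x s) 0 s * (0 - ?xi))
        \<le> (\<Sum>j\<in>N_set (\<sigma> s) i. a i j (x s) 0 s * (x s $ j $ l - ?xi))"
      using nonneg s by (intro sum_mono mult_left_mono) (auto simp: a_nonneg)
    ultimately show ?thesis
      unfolding follower_rhs_nth by (simp add: sum_distrib_right sum_negf distrib_right)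
  qed
  define c where "c = exp (- K * t0)"
  have early: "exp (- K * t) - x t $ i $ l \<le> 0" if t: "0 \<le> t" "t \<le> t0" for t i l
  proof (rule barrier[of 0 t])
    show "continuous_on {0..t} (\<lambda>s. exp (- K * s) - x s $ i $ l)"
      by (intro continuous_intros cont) simp
    fix s assume s: "0 \<le> s" "s \<le> t"
      and ge: "\<And>r. s \<le> r \<Longrightarrow> r \<le> t \<Longrightarrow> 0 \<le> exp (- K * r) - x r $ i $ l"
    have C0: "0 \<le> K"
    proof -
      have "0 \<le> C 0" unfolding C_def
        by (auto intro!: sum_nonneg add_nonneg_nonneg simp: a_nonneg b_nonneg)
      then show ?thesis using K[of 0] t0 by simp
    qed
    have "((\<lambda>r. - K * exp (- K * r)) has_integral (exp (- K * t) - exp (- K * s))) {s..t}"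
      by (intro fundamental_theorem_of_calculus s)
         (auto intro!: derivative_eq_intros simp flip: has_real_derivative_iff_has_vector_derivative)
    then have "exp (- K * t) - exp (- K * s) \<le> x t $ i $ l - x s $ i $ l"
    proof (rule has_integral_le[OF _ inc[OF s]])
      fix r assume r: "r \<in> {s..t}"
      have "- K * exp (- K * r) \<le> - K * x r $ i $ l"
        using ge[of r] r C0 by (intro mult_left_mono_neg) auto
      also have "\<dots> \<le> ?rhs r $ i $ l" using rhs_ge r s t by auto
      finally show "- K * exp (- K * r) \<le> ?rhs r $ i $ l" .
    qed
    then show "exp (- K * t) - x t $ i $ l \<le> exp (- K * s) - x s $ i $ l" by simp
  qed (use t x0 in auto)
  \<comment> \<open>By induction the in-neighbours, again in \<open>A\<close>, stay above
    \<open>c\<close>; a coordinate at or below \<open>c\<close> then cannot decrease.\<close>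
  have late: "\<forall>t\<ge>t0. i \<in> A \<longrightarrow> c \<le> x t $ i $ l" for i l
  proof (induction i rule: wf_induct_rule[OF wf_follower_arcs])
    case (1 i)
    have "- (x t $ i $ l) \<le> - c" if t: "t0 \<le> t" and "i \<in> A" for t
    proof (rule barrier[of t0 t])
      show "continuous_on {t0..t} (\<lambda>s. - (x s $ i $ l))" by (intro continuous_intros cont t0)
      show "- (x t0 $ i $ l) \<le> - c" using early[OF t0 order_refl, of i l] by (simp add: c_def)
      fix s assume s: "t0 \<le> s" "s \<le> t"
        and ge: "\<And>r. s \<le> r \<Longrightarrow> r \<le> t \<Longrightarrow> - c \<le> - (x r $ i $ l)"
      have rate: "0 \<le> ?rhs r $ i $ l" if r: "r \<in> {s..t}" for r
      proof -
        have r': "t0 \<le> r" "0 \<le> r" using r s t0 by auto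
        have "c \<le> x r $ j $ l" if "j \<in> N_set (\<sigma> r) i" for j
          using 1[OF N_set_follower_arcs[OF r'(2) that]] A_N[OF r'(1) \<open>i \<in> A\<close> that] r' by blast
        moreover have "x r $ i $ l \<le> c" using ge[of r] r by simp
        ultimately have "0 \<le> a i j (x r) 0 r * (x r $ j $ l - x r $ i $ l)" if "j \<in> N_set (\<sigma> r) i" for j
          using that a_nonneg by (intro mult_nonneg_nonneg) (auto intro: order_trans)
        then show ?thesis
          unfolding follower_rhs_nth A_L[OF r'(1) \<open>i \<in> A\<close>] by (auto intro: sum_nonneg)
      qed
      have "0 \<le> x t $ i $ l - x s $ i $ l"
        using s t0 by (intro has_integral_le[OF has_integral_0 inc[of s t i l] rate]) auto
      then show "- (x t $ i $ l) \<le> - (x s $ i $ l)" by simp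
    qed (rule t)
    then show ?case by auto
  qed
  obtain \<beta> \<gamma> where \<beta>\<gamma>: "class_KL \<beta> \<and> class_K \<gamma> \<and>
      (\<forall>u w x y. admissible_inputs u w \<longrightarrow> sys5_solution \<sigma> a b u w x y \<longrightarrow>
        (\<forall>t\<ge>0. ennreal (dist_L (x t) (y t)) \<le> ennreal (\<beta> (dist_L (x 0) (y 0)) t)
            + set_nn_integral lborel {0..t} (\<lambda>s. ennreal (\<gamma> (norm (u (y s) s, w s))))))"
    using assms unfolding SiISS_def by (elim exE) (rule that)
  then have KL: "class_KL \<beta>" and "class_K \<gamma>" by simp_all
  have "\<gamma> 0 = 0" using \<open>class_K \<gamma>\<close> by (simp add: class_K_def)
  have adm: "admissible_inputs (\<lambda>_ _. 0 :: real^'d^'k) (\<lambda>_. 0 :: real^'d^'n)"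
    by (auto simp: admissible_inputs_def piecewise_cont_nonneg_def intro!: exI[of _ "{}"] exI[of _ 0])
  define r where "r = dist_L (x 0) (0 :: real^'d^'k)"
  \<comment> \<open>The leader hull is the origin, so one coordinate bounds the distance from below;
    the input integral vanishes because \<open>\<gamma> 0 = 0\<close>.\<close>
  have "c \<le> \<beta> r t" if t: "t0 \<le> t" for t
  proof -
    have "c \<le> x t $ i0 $ undefined" using late t i0 by (simp add: A_def)
    then have "c \<le> \<bar>x t $ i0 $ undefined\<bar>" by linarith
    also have "\<dots> \<le> norm (x t $ i0)" by (rule component_le_norm_cart)
    also have "\<dots> \<le> dist_L (x t) (0 :: real^'d^'k)"
      using infdist_le_dist_L[of "x t" i0 "0 :: real^'d^'k"] by (simp add: infdist_leader_hull_0)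
    finally have "ennreal c \<le> ennreal (dist_L (x t) (0 :: real^'d^'k))" by (rule ennreal_leI)
    also have "\<dots> \<le> ennreal (\<beta> r t)"
      using \<beta>\<gamma>[THEN conjunct2, THEN conjunct2, rule_format, OF adm sol, of t] t t0 \<open>\<gamma> 0 = 0\<close> by (simp add: r_def zero_prod_def[symmetric])
    finally show ?thesis by (auto simp: ennreal_le_iff2 c_def not_le[symmetric])
  qed
  moreover have "((\<lambda>t. \<beta> r t) \<longlongrightarrow> 0) at_top"
    using KL dist_L_nonneg[of "x 0" "0 :: real^'d^'k"] by (simp add: class_KL_def r_def)
  then have "\<forall>\<^sub>F t in at_top. \<beta> r t < c"
    by (rule order_tendstoD) (simp add: c_def)
  then have "\<forall>\<^sub>F t in at_top. \<beta> r t < c \<and> t0 \<le> t"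
    using eventually_ge_at_top by (rule eventually_conj)
  then have "\<exists>t. \<beta> r t < c \<and> t0 \<le> t"
    using eventually_happens'[of "at_top :: real filter" "\<lambda>t. \<beta> r t < c \<and> t0 \<le> t"] by simp
  ultimately show False by (meson not_le)
qed

end

theorem theorem4:
  fixes \<sigma> :: "real \<Rightarrow> ('n::finite + 'k::finite) rel"
    and \<tau>D :: real
    and a :: "'n \<Rightarrow> 'n \<Rightarrow> real^'d::finite^'n \<Rightarrow> real^'d^'k \<Rightarrow> real \<Rightarrow> real"
    and b :: "'n \<Rightarrow> 'k \<Rightarrow> real^'d^'n \<Rightarrow> real^'d^'k \<Rightarrow> real \<Rightarrow> real"
    and a_lo a_hi b_lo :: real
  assumes n_ge2: "CARD('n) \<ge> 2"
    and dwell: "dwell_time_signal \<sigma> \<tau>D"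
    and no_arc_into_leader: "\<forall>t\<ge>0. \<forall>(p, q)\<in>\<sigma> t. q \<in> range Inl"
    and a_cont: "\<forall>i j. continuous_on UNIV (\<lambda>(x, y, t). a i j x y t)"
    and b_cont: "\<forall>i j. continuous_on UNIV (\<lambda>(x, y, t). b i j x y t)"
    and a_bounds: "0 < a_lo" "a_lo \<le> a_hi" "\<forall>i j x y t. a_lo \<le> a i j x y t \<and> a i j x y t \<le> a_hi"
    and b_bound: "0 < b_lo" "\<forall>i j x y t. b_lo \<le> b i j x y t"
    and acyc: "acyclic (follower_subgraph (joint_graph \<sigma> {0..}))"
  shows "SiISS \<sigma> a b \<longleftrightarrow> JLC \<sigma>"
proof -
  interpret switched_network \<sigma> \<tau>D a b a_lo b_lo
    by (unfold_locales; use assms in \<open>blast\<close>)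
  show ?thesis using SiISS_imp_JLC JLC_imp_SiISS by blast
qed

end
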